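(* Let $G$ be a finite, simple, connected graph and work with coefficients in a field $\mathbb{K}$. There exists a quasi-isomorphism between the bold chain complex $\mathrm{C}\mathbb{H}(G)$ and the complex $\mathrm{D}\mathbb{H}(G)$, which is spanned by the connected dominating sets of $G$ and whose differential is induced by inclusions.
   Context: Bold chain complex. Let $G$ be a finite simple graph; order $V(G)$. A bi-colouring is a map $\varepsilon\colon V(G)\to\{0,1\}$, and $G_\varepsilon$ denotes the subgraph of $G$ induced by the vertices $v$ with $\varepsilon(v)=1$. Write $\varepsilon\,\widetilde{\triangleleft}\,\varepsilon'$ if $\varepsilon'$ is obtained from $\varepsilon$ by changing the value at exactly one vertex from $0$ to $1$. A sign assignment is a choice of $s(\varepsilon,\varepsilon')\in\mathbb{Z}/2$ for each such pair with $s(\varepsilon,\varepsilon_1)+s(\varepsilon_1,\varepsilon'')\equiv s(\varepsilon,\varepsilon_2)+s(\varepsilon_2,\varepsilon'')+1\pmod 2$ whenever $\varepsilon\,\widetilde{\triangleleft}\,\varepsilon_1,\varepsilon_2\,\widetilde{\triangleleft}\,\varepsilon''$, $\varepsilon_1\neq\varepsilon_2$; it exists and the choice does not affect the complex up to isomorphism. The bold chain group is \[\mathrm{C}\mathbb{H}_i(G)=\bigoplus_{\varepsilon:\ \sum_v\varepsilon(v)=i}\ \bigoplus_{x\in\pi_0(G_\varepsilon)}\mathbb{K}\langle x\rangle,\] where $\pi_0$ is the set of connected components (so $\mathrm{C}\mathbb{H}_0=0$), with differential $d^i\colon \mathrm{C}\mathbb{H}_i\to\mathrm{C}\mathbb{H}_{i+1}$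 given for $x\in\pi_0(G_\varepsilon)$ by $d^i(x)=\sum(-1)^{s(\varepsilon,\varepsilon')}y$, the sum over all $\varepsilon'$ with $\varepsilon\,\widetilde{\triangleleft}\,\varepsilon'$ and the component $y\in\pi_0(G_{\varepsilon'})$ with $V(x)\subseteq V(y)$. Dominating complex. A subset $D\subseteq V(G)$ is dominating if every vertex of $V(G)\setminus D$ is adjacent to some member of $D$; it is a connected dominating set if moreover its induced subgraph is connected. $\mathrm{D}\mathbb{H}(G)$ is the sub-complex of $\mathrm{C}\mathbb{H}(G)$ spanned by those $x\in\pi_0(G_\varepsilon)$ (for all $\varepsilon$) such that $V(x)$ is a dominating set of $G$; such generators correspond bijectively to connected dominating sets $D$ of $G$ (in degree $|D|$; then necessarily $G_\varepsilon=x$), and the differential sends $D$ to the signed sum of the sets $D\cup\{v\}$, $v\in V(G)\setminus D$. *)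

theory Defs
  imports
    "Graph_Theory.Digraph_Component"
    "HOL-Library.FuncSet"
    "HOL-Library.Poly_Mapping"
    "HOL-Library.Z2"
begin

section \<open>Complexes of vector spaces of formal linear combinations\<close>

definition scale_chain :: "'k::field \<Rightarrow> ('g \<Rightarrow>\<^sub>0 'k) \<Rightarrow> ('g \<Rightarrow>\<^sub>0 'k)" where
  "scale_chain c p = Poly_Mapping.map ((*) c) p"

definition extend_linearly ::
    "('g \<Rightarrow> ('h \<Rightarrow>\<^sub>0 'k)) \<Rightarrow> ('g \<Rightarrow>\<^sub>0 'k::field) \<Rightarrow> ('h \<Rightarrow>\<^sub>0 'k)" where
  "extend_linearly b p =
     (\<Sum>g\<in>Poly_Mapping.keys p. scale_chain (Poly_Mapping.lookup p g) (b g))"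

definition linear_subspace :: "('g \<Rightarrow>\<^sub>0 'k::field) set \<Rightarrow> bool" where
  "linear_subspace U \<longleftrightarrow>
     0 \<in> U \<and> (\<forall>x\<in>U. \<forall>y\<in>U. x + y \<in> U) \<and> (\<forall>c. \<forall>x\<in>U. scale_chain c x \<in> U)"

definition linear_between ::
    "('g \<Rightarrow>\<^sub>0 'k::field) set \<Rightarrow> ('h \<Rightarrow>\<^sub>0 'k) set \<Rightarrow> (('g \<Rightarrow>\<^sub>0 'k) \<Rightarrow> ('h \<Rightarrow>\<^sub>0 'k)) \<Rightarrow> bool" where
  "linear_between U W f \<longleftrightarrow>
     (\<forall>x\<in>U. f x \<in> W) \<and>
     (\<forall>x\<in>U. \<forall>y\<in>U. f (x + y) = f x + f y) \<and>
     (\<forall>c. \<forall>x\<in>U. f (scale_chain c x) = scale_chain c (f x))"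

record (overloaded) ('g, 'k) cpx =
  chains :: "nat \<Rightarrow> ('g \<Rightarrow>\<^sub>0 'k::zero) set"
  diff :: "nat \<Rightarrow> ('g \<Rightarrow>\<^sub>0 'k) \<Rightarrow> ('g \<Rightarrow>\<^sub>0 'k)"

text \<open>Differentials raise the degree by one; there is nothing in negative degrees.\<close>

definition chain_complex :: "('g, 'k::field) cpx \<Rightarrow> bool" where
  "chain_complex C \<longleftrightarrow>
     (\<forall>i. linear_subspace (chains C i)) \<and>
     (\<forall>i. linear_between (chains C i) (chains C (Suc i)) (diff C i)) \<and>
     (\<forall>i. \<forall>x\<in>chains C i. diff C (Suc i) (diff C i x) = 0)"

definition cycles :: "('g, 'k::field) cpx \<Rightarrow> nat \<Rightarrow> ('g \<Rightarrow>\<^sub>0 'k) set" where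
  "cycles C i = {x \<in> chains C i. diff C i x = 0}"

definition boundaries :: "('g, 'k::field) cpx \<Rightarrow> nat \<Rightarrow> ('g \<Rightarrow>\<^sub>0 'k) set" where
  "boundaries C i = (case i of 0 \<Rightarrow> {0} | Suc j \<Rightarrow> diff C j ` chains C j)"

definition homologous :: "('g, 'k::field) cpx \<Rightarrow> nat \<Rightarrow> (('g \<Rightarrow>\<^sub>0 'k) \<times> ('g \<Rightarrow>\<^sub>0 'k)) set" where
  "homologous C i = {(x, y). x \<in> cycles C i \<and> y \<in> cycles C i \<and> x - y \<in> boundaries C i}"

text \<open>The underlying set of the quotient space of cycles modulo boundaries.\<close>

definition homology :: "('g, 'k::field) cpx \<Rightarrow> nat \<Rightarrow> ('g \<Rightarrow>\<^sub>0 'k) set set" where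
  "homology C i = cycles C i // homologous C i"

definition chain_map ::
    "('g, 'k::field) cpx \<Rightarrow> ('h, 'k) cpx \<Rightarrow> (nat \<Rightarrow> ('g \<Rightarrow>\<^sub>0 'k) \<Rightarrow> ('h \<Rightarrow>\<^sub>0 'k)) \<Rightarrow> bool" where
  "chain_map C D f \<longleftrightarrow>
     (\<forall>i. linear_between (chains C i) (chains D i) (f i)) \<and>
     (\<forall>i. \<forall>x\<in>chains C i. f (Suc i) (diff C i x) = diff D i (f i x))"

text \<open>For a chain map \<open>f\<close> this sends the class of a cycle \<open>x\<close> to the class of \<open>f i x\<close>.\<close>

definition homology_map ::
    "('g, 'k::field) cpx \<Rightarrow> ('h, 'k) cpx \<Rightarrow> (nat \<Rightarrow> ('g \<Rightarrow>\<^sub>0 'k) \<Rightarrow> ('h \<Rightarrow>\<^sub>0 'k)) \<Rightarrow>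
     nat \<Rightarrow> ('g \<Rightarrow>\<^sub>0 'k) set \<Rightarrow> ('h \<Rightarrow>\<^sub>0 'k) set" where
  "homology_map C D f i X = homologous D i `` (f i ` X)"

text \<open>The map induced by a chain map is linear, so it is an isomorphism iff it is bijective.\<close>

definition quasi_isomorphism ::
    "('g, 'k::field) cpx \<Rightarrow> ('h, 'k) cpx \<Rightarrow> (nat \<Rightarrow> ('g \<Rightarrow>\<^sub>0 'k) \<Rightarrow> ('h \<Rightarrow>\<^sub>0 'k)) \<Rightarrow> bool" where
  "quasi_isomorphism C D f \<longleftrightarrow>
     chain_complex C \<and> chain_complex D \<and> chain_map C D f \<and>
     (\<forall>i. bij_betw (homology_map C D f i) (homology C i) (homology D i))"


section \<open>The bold chain complex\<close>

text \<open>
  A finite simple graph is a digraph satisfying the locale \<open>graph\<close>: finite, without loops or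
  parallel arcs, and symmetric.  By symmetry its strongly connected components are its connected
  components; a component is represented by its vertex set.  Bi-colourings are extensional
  functions, so that they are determined by their values on the vertices.
\<close>

definition bicolourings :: "('a, 'b) pre_digraph \<Rightarrow> ('a \<Rightarrow> nat) set" where
  "bicolourings G = verts G \<rightarrow>\<^sub>E {0, 1}"

definition coloured_subgraph ::
    "('a, 'b) pre_digraph \<Rightarrow> ('a \<Rightarrow> nat) \<Rightarrow> ('a, 'b) pre_digraph" where
  "coloured_subgraph G \<epsilon> = G \<restriction> {v \<in> verts G. \<epsilon> v = 1}"

definition flip_up :: "('a, 'b) pre_digraph \<Rightarrow> ('a \<Rightarrow> nat) \<Rightarrow> ('a \<Rightarrow> nat) \<Rightarrow> bool" where
  "flip_up G \<epsilon> \<epsilon>' \<longleftrightarrow>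
     \<epsilon> \<in> bicolourings G \<and> (\<exists>v\<in>verts G. \<epsilon> v = 0 \<and> \<epsilon>' = \<epsilon>(v := 1))"

definition sign_assignment ::
    "('a, 'b) pre_digraph \<Rightarrow> (('a \<Rightarrow> nat) \<Rightarrow> ('a \<Rightarrow> nat) \<Rightarrow> bit) \<Rightarrow> bool" where
  "sign_assignment G s \<longleftrightarrow>
     (\<forall>\<epsilon> \<epsilon>\<^sub>1 \<epsilon>\<^sub>2 \<epsilon>''.
        flip_up G \<epsilon> \<epsilon>\<^sub>1 \<and> flip_up G \<epsilon> \<epsilon>\<^sub>2 \<and> flip_up G \<epsilon>\<^sub>1 \<epsilon>'' \<and> flip_up G \<epsilon>\<^sub>2 \<epsilon>'' \<and> \<epsilon>\<^sub>1 \<noteq> \<epsilon>\<^sub>2 \<longrightarrow>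
        s \<epsilon> \<epsilon>\<^sub>1 + s \<epsilon>\<^sub>1 \<epsilon>'' = s \<epsilon> \<epsilon>\<^sub>2 + s \<epsilon>\<^sub>2 \<epsilon>'' + 1)"

definition sign_of_bit :: "bit \<Rightarrow> 'k::field" where
  "sign_of_bit b = (if b = 0 then 1 else - 1)"

definition components :: "('a, 'b) pre_digraph \<Rightarrow> 'a set set" where
  "components H = pre_digraph.sccs_verts H"

type_synonym 'a bold_gen = "('a \<Rightarrow> nat) \<times> 'a set"

definition bold_gens :: "('a, 'b) pre_digraph \<Rightarrow> nat \<Rightarrow> 'a bold_gen set" where
  "bold_gens G i =
     {(\<epsilon>, X). \<epsilon> \<in> bicolourings G \<and> (\<Sum>v\<in>verts G. \<epsilon> v) = i \<and> X \<in> components (coloured_subgraph G \<epsilon>)}"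

definition bold_diff_gen ::
    "('a, 'b) pre_digraph \<Rightarrow> (('a \<Rightarrow> nat) \<Rightarrow> ('a \<Rightarrow> nat) \<Rightarrow> bit) \<Rightarrow>
     'a bold_gen \<Rightarrow> ('a bold_gen \<Rightarrow>\<^sub>0 'k::field)" where
  "bold_diff_gen G s = (\<lambda>(\<epsilon>, X).
     \<Sum>(\<epsilon>', Y) \<in> {(\<epsilon>', Y). flip_up G \<epsilon> \<epsilon>' \<and> Y \<in> components (coloured_subgraph G \<epsilon>') \<and> X \<subseteq> Y}.
       Poly_Mapping.single (\<epsilon>', Y) (sign_of_bit (s \<epsilon> \<epsilon>')))"

definition bold_complex ::
    "('a, 'b) pre_digraph \<Rightarrow> (('a \<Rightarrow> nat) \<Rightarrow> ('a \<Rightarrow> nat) \<Rightarrow> bit) \<Rightarrow> ('a bold_gen, 'k::field) cpx" where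
  "bold_complex G s =
     \<lparr> chains = (\<lambda>i. {p. Poly_Mapping.keys p \<subseteq> bold_gens G i}),
       diff = (\<lambda>i. extend_linearly (bold_diff_gen G s)) \<rparr>"


section \<open>The complex of connected dominating sets\<close>

definition dominating_set :: "('a, 'b) pre_digraph \<Rightarrow> 'a set \<Rightarrow> bool" where
  "dominating_set G D \<longleftrightarrow>
     D \<subseteq> verts G \<and> (\<forall>v \<in> verts G - D. \<exists>u \<in> D. u \<rightarrow>\<^bsub>G\<^esub> v)"

definition connected_dominating_set :: "('a, 'b) pre_digraph \<Rightarrow> 'a set \<Rightarrow> bool" where
  "connected_dominating_set G D \<longleftrightarrow>
     dominating_set G D \<and> Digraph_Component.connected (G \<restriction> D)"

definition dominating_gens :: "('a, 'b) pre_digraph \<Rightarrow> nat \<Rightarrow> 'a bold_gen set" where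
  "dominating_gens G i = {(\<epsilon>, X) \<in> bold_gens G i. dominating_set G X}"

definition dominating_complex ::
    "('a, 'b) pre_digraph \<Rightarrow> (('a \<Rightarrow> nat) \<Rightarrow> ('a \<Rightarrow> nat) \<Rightarrow> bit) \<Rightarrow> ('a bold_gen, 'k::field) cpx" where
  "dominating_complex G s =
     \<lparr> chains = (\<lambda>i. {p. Poly_Mapping.keys p \<subseteq> dominating_gens G i}),
       diff = diff (bold_complex G s) \<rparr>"

text \<open>
  The generators of the dominating complex are the connected dominating sets \<open>D\<close> (each with the
  bi-colouring marking \<open>D\<close>), and its differential adds vertices one at a time.
\<close>

definition marking :: "('a, 'b) pre_digraph \<Rightarrow> 'a set \<Rightarrow> ('a \<Rightarrow> nat)" where
  "marking G D = (\<lambda>v\<in>verts G. if v \<in> D then 1 else 0)"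

lemma coloured_subgraph_marking:
  "D \<subseteq> verts G \<Longrightarrow> coloured_subgraph G (marking G D) = G \<restriction> D"
  unfolding coloured_subgraph_def marking_def
  by (rule arg_cong[where f = "induce_subgraph G"]) auto

lemma marking_bicolouring: "marking G D \<in> bicolourings G"
  by (auto simp: marking_def bicolourings_def)

lemma strongly_connected_imp_connected:
  assumes "wf_digraph H" "strongly_connected H"
  shows "Digraph_Component.connected H"
proof -
  interpret wf_digraph H by fact
  show ?thesis
    using assms(2) reachable_mk_symmetricI
    by (auto simp: connected_def strongly_connected_def)
qed

lemma connected_induced_component:
  assumes "graph G" "D \<subseteq> verts G"
  shows "D \<in> components (G \<restriction> D) \<longleftrightarrow> Digraph_Component.connected (G \<restriction> D)"
proof -
  interpret graph G by fact
  interpret H: wf_digraph "G \<restriction> D" by auto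
  have "induced_subgraph (G \<restriction> D) G"
    using assms by (intro induced_induce) auto
  then have sym: "symmetric (G \<restriction> D)"
    by (rule induced_graph_imp_symmetric[OF sym_arcs])
  have "D \<in> components (G \<restriction> D) \<longleftrightarrow> strongly_connected (G \<restriction> D)"
  proof
    assume "D \<in> components (G \<restriction> D)"
    then show "strongly_connected (G \<restriction> D)"
      by (simp add: components_def pre_digraph.sccs_verts_def strongly_connected_def)
  next
    assume "strongly_connected (G \<restriction> D)"
    moreover have "\<not> u \<rightarrow>\<^sup>*\<^bsub>G \<restriction> D\<^esub> v" if "v \<notin> D" for u v
      using H.reachable_in_verts(2)[of u v] that by auto
    ultimately show "D \<in> components (G \<restriction> D)"
      by (simp add: components_def pre_digraph.sccs_verts_def strongly_connected_def)
  qed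
  moreover have "strongly_connected (G \<restriction> D) \<longleftrightarrow> Digraph_Component.connected (G \<restriction> D)"
    using sym H.symmetric_connected_imp_strongly_connected
      strongly_connected_imp_connected[OF H.wf_digraph] by blast
  ultimately show ?thesis by simp
qed

lemma dominating_component_unique:
  assumes "graph G" "S \<subseteq> verts G" "X \<in> components (G \<restriction> S)" "dominating_set G X"
  shows "X = S"
proof -
  interpret graph G by fact
  interpret H: wf_digraph "G \<restriction> S" by auto
  have sym: "symmetric (G \<restriction> S)"
    using assms(2) by (intro induced_graph_imp_symmetric[OF sym_arcs] induced_induce)
  have X: "\<forall>u\<in>X. \<forall>v\<in>X. u \<rightarrow>\<^sup>*\<^bsub>G \<restriction> S\<^esub> v"
    "\<forall>u\<in>X. \<forall>v. v \<notin> X \<longrightarrow> \<not> u \<rightarrow>\<^sup>*\<^bsub>G \<restriction> S\<^esub> v \<or> \<not> v \<rightarrow>\<^sup>*\<^bsub>G \<restriction> S\<^esub> u"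
    using assms(3) unfolding components_def pre_digraph.sccs_verts_def by auto
  have "X \<subseteq> S" using X(1) H.reachable_in_verts by fastforce
  moreover have "v \<in> X" if v: "v \<in> S" for v
  proof (rule ccontr)
    assume "v \<notin> X"
    with v assms(2,4) obtain u where u: "u \<in> X" "u \<rightarrow>\<^bsub>G\<^esub> v"
      unfolding dominating_set_def by blast
    then obtain e where "e \<in> arcs G" "tail G e = u" "head G e = v"
      by (auto simp: arcs_ends_conv)
    then have "u \<rightarrow>\<^bsub>G \<restriction> S\<^esub> v"
      using u \<open>X \<subseteq> S\<close> v by (auto simp: arcs_ends_conv intro!: rev_image_eqI)
    then have "u \<rightarrow>\<^sup>*\<^bsub>G \<restriction> S\<^esub> v" by (rule H.reachable_adjI)
    with symmetric_reachable[OF sym this] X(2) u \<open>v \<notin> X\<close> show False by blast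
  qed
  ultimately show ?thesis by blast
qed

lemma bicolouring_eq_marking:
  assumes "\<epsilon> \<in> bicolourings G"
  shows "\<epsilon> = marking G {v \<in> verts G. \<epsilon> v = 1}"
proof
  fix v show "\<epsilon> v = marking G {v \<in> verts G. \<epsilon> v = 1} v"
    using assms by (auto simp: bicolourings_def marking_def PiE_def Pi_def extensional_def)
qed

lemma sum_marking:
  assumes "graph G" "D \<subseteq> verts G"
  shows "(\<Sum>v\<in>verts G. marking G D v) = card D"
proof -
  interpret graph G by fact
  have "(\<Sum>v\<in>verts G. marking G D v) = (\<Sum>v\<in>verts G. if v \<in> D then 1 else 0)"
    by (rule sum.cong) (auto simp: marking_def)
  also have "\<dots> = card (verts G \<inter> D)"
    by (simp add: sum.If_cases)
  finally show ?thesis using assms(2) by (simp add: Int_absorb1)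
qed

lemma dominating_gens_eq:
  assumes "graph G"
  shows "dominating_gens G i =
    (\<lambda>D. (marking G D, D)) ` {D. connected_dominating_set G D \<and> card D = i}"
proof (intro equalityI subsetI)
  fix g assume "g \<in> dominating_gens G i"
  then obtain \<epsilon> X where g: "g = (\<epsilon>, X)" "\<epsilon> \<in> bicolourings G" "(\<Sum>v\<in>verts G. \<epsilon> v) = i"
    "X \<in> components (coloured_subgraph G \<epsilon>)" "dominating_set G X"
    unfolding dominating_gens_def bold_gens_def by auto
  let ?S = "{v \<in> verts G. \<epsilon> v = 1}"
  have X: "X = ?S"
    using dominating_component_unique[OF assms, of ?S X] g by (auto simp: coloured_subgraph_def)
  then have m: "\<epsilon> = marking G X" using bicolouring_eq_marking[OF g(2)] by simp
  have XG: "X \<subseteq> verts G" using X by auto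
  have "connected_dominating_set G X"
    using g(4,5) connected_induced_component[OF assms XG] coloured_subgraph_marking[OF XG]
    unfolding m connected_dominating_set_def by simp
  moreover have "card X = i" using g(3) sum_marking[OF assms XG] unfolding m by simp
  ultimately show "g \<in> (\<lambda>D. (marking G D, D)) ` {D. connected_dominating_set G D \<and> card D = i}"
    using g(1) m by blast
next
  fix g assume "g \<in> (\<lambda>D. (marking G D, D)) ` {D. connected_dominating_set G D \<and> card D = i}"
  then obtain D where D: "g = (marking G D, D)" "connected_dominating_set G D" "card D = i"
    by blast
  then have DG: "D \<subseteq> verts G"
    by (auto simp: connected_dominating_set_def dominating_set_def)
  then show "g \<in> dominating_gens G i"
    using D connected_induced_component[OF assms DG] coloured_subgraph_marking[OF DG]
      sum_marking[OF assms DG] marking_bicolouring[of G D]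
    by (auto simp: dominating_gens_def bold_gens_def connected_dominating_set_def)
qed

lemma flip_up_marking:
  assumes "D \<subseteq> verts G"
  shows "flip_up G (marking G D) \<epsilon>' \<longleftrightarrow> (\<exists>v\<in>verts G - D. \<epsilon>' = marking G (insert v D))"
proof -
  have "(marking G D)(v := 1) = marking G (insert v D)" if "v \<in> verts G" for v
    using that by (auto simp: marking_def fun_eq_iff)
  moreover have "marking G D v = 0 \<longleftrightarrow> v \<notin> D" if "v \<in> verts G" for v
    using that by (auto simp: marking_def)
  ultimately show ?thesis
    unfolding flip_up_def using marking_bicolouring[of G D] by (metis DiffE DiffI)
qed

lemma connected_dominating_insert:
  assumes "graph G" "connected_dominating_set G D" "v \<in> verts G"
  shows "connected_dominating_set G (insert v D)"
proof (cases "v \<in> D")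
  case True
  with assms(2) show ?thesis by (simp add: insert_absorb)
next
  case False
  interpret graph G by fact
  let ?H = "G \<restriction> insert v D"
  interpret H: wf_digraph ?H by auto
  have DG: "D \<subseteq> verts G" and dom: "dominating_set G D"
    using assms(2) by (auto simp: connected_dominating_set_def dominating_set_def)
  have sym: "symmetric ?H"
    using DG assms(3) by (intro induced_graph_imp_symmetric[OF sym_arcs] induced_induce) auto
  have "D \<in> components (G \<restriction> D)"
    using connected_induced_component[OF assms(1) DG] assms(2)
    by (simp add: connected_dominating_set_def)
  then have "\<forall>x\<in>D. \<forall>y\<in>D. x \<rightarrow>\<^sup>*\<^bsub>G \<restriction> D\<^esub> y"
    unfolding components_def pre_digraph.sccs_verts_def by auto
  then have D: "x \<rightarrow>\<^sup>*\<^bsub>?H\<^esub> y" if "x \<in> D" "y \<in> D" for x y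
    using that reachable_induce_ss[of D x y "insert v D"] by blast
  obtain u where u: "u \<in> D" "u \<rightarrow>\<^bsub>G\<^esub> v"
    using dom False assms(3) unfolding dominating_set_def by blast
  then obtain e where "e \<in> arcs G" "tail G e = u" "head G e = v"
    by (auto simp: arcs_ends_conv)
  then have "u \<rightarrow>\<^bsub>?H\<^esub> v"
    using u by (auto simp: arcs_ends_conv intro!: rev_image_eqI)
  then have uv: "u \<rightarrow>\<^sup>*\<^bsub>?H\<^esub> v" by (rule H.reachable_adjI)
  have to_v: "x \<rightarrow>\<^sup>*\<^bsub>?H\<^esub> v" if "x \<in> insert v D" for x
    using that D[of x u] u uv H.reachable_trans[of x u v] H.reachable_refl[of v] by auto
  have from_v: "v \<rightarrow>\<^sup>*\<^bsub>?H\<^esub> x" if "x \<in> insert v D" for x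
    by (rule symmetric_reachable[OF sym to_v[OF that]])
  have "x \<rightarrow>\<^sup>*\<^bsub>?H\<^esub> y" if "x \<in> insert v D" "y \<in> insert v D" for x y
    using H.reachable_trans to_v[OF that(1)] from_v[OF that(2)] by blast
  then have "strongly_connected ?H" by (auto simp: strongly_connected_def)
  then have "Digraph_Component.connected ?H" by (rule strongly_connected_imp_connected[OF H.wf_digraph])
  moreover have "dominating_set G (insert v D)"
    using dom assms(3) by (auto simp: dominating_set_def)
  ultimately show ?thesis by (simp add: connected_dominating_set_def)
qed

lemma bold_diff_gen_dominating:
  assumes "graph G" "connected_dominating_set G D"
  shows "bold_diff_gen G s (marking G D, D) =
    (\<Sum>v\<in>verts G - D. Poly_Mapping.single (marking G (insert v D), insert v D)
       (sign_of_bit (s (marking G D) (marking G (insert v D)))))"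
proof -
  have DG: "D \<subseteq> verts G" and dom: "dominating_set G D"
    using assms(2) by (auto simp: connected_dominating_set_def dominating_set_def)
  let ?I = "{(\<epsilon>', Y). flip_up G (marking G D) \<epsilon>' \<and>
               Y \<in> components (coloured_subgraph G \<epsilon>') \<and> D \<subseteq> Y}"
  let ?h = "\<lambda>v. (marking G (insert v D), insert v D)"
  have comp: "Y \<in> components (coloured_subgraph G (marking G (insert v D))) \<and> D \<subseteq> Y
      \<longleftrightarrow> Y = insert v D" if v: "v \<in> verts G" for v Y
  proof -
    have vD: "insert v D \<subseteq> verts G" using v DG by auto
    have "Y = insert v D" if Y: "Y \<in> components (G \<restriction> insert v D)" "D \<subseteq> Y"
    proof -
      interpret graph G by fact
      interpret H: wf_digraph "G \<restriction> insert v D" by auto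
      have "Y \<subseteq> insert v D"
        using Y(1) H.reachable_in_verts
        unfolding components_def pre_digraph.sccs_verts_def by fastforce
      then have "dominating_set G Y"
        using dom Y(2) vD unfolding dominating_set_def by blast
      then show ?thesis by (rule dominating_component_unique[OF assms(1) vD Y(1)])
    qed
    moreover have "insert v D \<in> components (G \<restriction> insert v D)"
      using connected_dominating_insert[OF assms v] connected_induced_component[OF assms(1) vD]
      by (simp add: connected_dominating_set_def)
    ultimately show ?thesis unfolding coloured_subgraph_marking[OF vD] by blast
  qed
  have "?I = ?h ` (verts G - D)"
  proof (intro equalityI subsetI)
    fix g assume "g \<in> ?I"
    then obtain v Y where "v \<in> verts G - D" "g = (marking G (insert v D), Y)"
      "Y \<in> components (coloured_subgraph G (marking G (insert v D)))" "D \<subseteq> Y"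
      unfolding flip_up_marking[OF DG] by blast
    with comp[of v Y] show "g \<in> ?h ` (verts G - D)" by blast
  next
    fix g assume "g \<in> ?h ` (verts G - D)"
    then obtain v where v: "v \<in> verts G - D" "g = ?h v" by blast
    with comp[of v "insert v D"] show "g \<in> ?I"
      unfolding flip_up_marking[OF DG] by blast
  qed
  moreover have "inj_on ?h (verts G - D)" by (auto simp: inj_on_def)
  ultimately show ?thesis
    unfolding bold_diff_gen_def by (simp add: sum.reindex)
qed

lemma sign_assignment_exists:
  assumes "graph G"
  shows "\<exists>s. sign_assignment G s"
proof -
  interpret graph G by fact
  obtain r :: "'a \<Rightarrow> nat" where r: "inj_on r (verts G)"
    using finite_imp_inj_to_nat_seg[OF finite_verts] by blast
  define pos where "pos \<epsilon> \<epsilon>' = (THE v. v \<in> verts G \<and> \<epsilon> v \<noteq> \<epsilon>' v)" for \<epsilon> \<epsilon>' :: "'a \<Rightarrow> nat"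
  define s :: "('a \<Rightarrow> nat) \<Rightarrow> ('a \<Rightarrow> nat) \<Rightarrow> bit" where
    "s \<epsilon> \<epsilon>' = (\<Sum>w\<in>{w \<in> verts G. r w < r (pos \<epsilon> \<epsilon>')}. of_nat (\<epsilon> w))" for \<epsilon> \<epsilon>'
  have s: "s \<epsilon> (\<epsilon>(v := 1)) = (\<Sum>w\<in>{w \<in> verts G. r w < r v}. of_nat (\<epsilon> w))"
    if "v \<in> verts G" "\<epsilon> v = 0" for \<epsilon> v
  proof -
    have "pos \<epsilon> (\<epsilon>(v := 1)) = v"
      unfolding pos_def by (rule the_equality) (use that in \<open>auto split: if_splits\<close>)
    then show ?thesis by (simp add: s_def)
  qed
  have upd: "(\<Sum>w\<in>{w \<in> verts G. r w < r v}. of_nat ((\<epsilon>(u := 1)) w)) =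
      (\<Sum>w\<in>{w \<in> verts G. r w < r v}. of_nat (\<epsilon> w)) + (if r u < r v then 1 else 0 :: bit)"
    if "u \<in> verts G" "\<epsilon> u = 0" for \<epsilon> :: "'a \<Rightarrow> nat" and u v
  proof -
    have "(\<Sum>w\<in>{w \<in> verts G. r w < r v}. of_nat ((\<epsilon>(u := 1)) w)) =
        (\<Sum>w\<in>{w \<in> verts G. r w < r v}. of_nat (\<epsilon> w) + (if w = u then 1 else 0 :: bit))"
      by (rule sum.cong) (use that in auto)
    also have "\<dots> = (\<Sum>w\<in>{w \<in> verts G. r w < r v}. of_nat (\<epsilon> w)) +
        (\<Sum>w\<in>{w \<in> verts G. r w < r v}. if w = u then 1 else 0 :: bit)"
      by (rule sum.distrib)
    also have "(\<Sum>w\<in>{w \<in> verts G. r w < r v}. if w = u then 1 else 0 :: bit) =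
        (if r u < r v then 1 else 0)"
      using that by (subst sum.delta) auto
    finally show ?thesis .
  qed
  have "sign_assignment G s"
    unfolding sign_assignment_def
  proof (intro allI impI, elim conjE)
    fix \<epsilon> \<epsilon>\<^sub>1 \<epsilon>\<^sub>2 \<epsilon>''
    assume f: "flip_up G \<epsilon> \<epsilon>\<^sub>1" "flip_up G \<epsilon> \<epsilon>\<^sub>2" "flip_up G \<epsilon>\<^sub>1 \<epsilon>''" "flip_up G \<epsilon>\<^sub>2 \<epsilon>''"
      and ne: "\<epsilon>\<^sub>1 \<noteq> \<epsilon>\<^sub>2"
    from f(1) obtain a where a: "a \<in> verts G" "\<epsilon> a = 0" "\<epsilon>\<^sub>1 = \<epsilon>(a := 1)"
      by (auto simp: flip_up_def)
    from f(2) obtain b where b: "b \<in> verts G" "\<epsilon> b = 0" "\<epsilon>\<^sub>2 = \<epsilon>(b := 1)"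
      by (auto simp: flip_up_def)
    from f(3) obtain c where c: "c \<in> verts G" "\<epsilon>\<^sub>1 c = 0" "\<epsilon>'' = \<epsilon>\<^sub>1(c := 1)"
      by (auto simp: flip_up_def)
    from f(4) obtain d where d: "d \<in> verts G" "\<epsilon>\<^sub>2 d = 0" "\<epsilon>'' = \<epsilon>\<^sub>2(d := 1)"
      by (auto simp: flip_up_def)
    have ab: "a \<noteq> b" using ne a b by auto
    have "c = b"
      using fun_cong[OF c(3), of b] fun_cong[OF d(3), of b] ab a b by (auto split: if_splits)
    moreover have "d = a"
      using fun_cong[OF c(3), of a] fun_cong[OF d(3), of a] ab a b by (auto split: if_splits)
    moreover have r: "r a \<noteq> r b" using r ab a(1) b(1) by (auto simp: inj_on_def)
    moreover define P where "P v = (\<Sum>w\<in>{w \<in> verts G. r w < r v}. of_nat (\<epsilon> w) :: bit)" for v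
    ultimately have "s \<epsilon> \<epsilon>\<^sub>1 = P a" "s \<epsilon> \<epsilon>\<^sub>2 = P b"
      "s \<epsilon>\<^sub>1 \<epsilon>'' = P b + (if r a < r b then 1 else 0)"
      "s \<epsilon>\<^sub>2 \<epsilon>'' = P a + (if r b < r a then 1 else 0)"
      using s[of a \<epsilon>] s[of b \<epsilon>] s[of b \<epsilon>\<^sub>1] s[of a \<epsilon>\<^sub>2] upd[of a \<epsilon> b] upd[of b \<epsilon> a] a b c d
      by metis+
    then show "s \<epsilon> \<epsilon>\<^sub>1 + s \<epsilon>\<^sub>1 \<epsilon>'' = s \<epsilon> \<epsilon>\<^sub>2 + s \<epsilon>\<^sub>2 \<epsilon>'' + 1"
      using r by (cases "P a"; cases "P b"; cases "r a < r b") auto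
  qed
  then show ?thesis by blast
qed

end

theory Submission
  imports Defs
begin

text \<open>
  The quasi-isomorphism is the inclusion of the dominating complex into the bold complex. It is one
  because the quotient complex is acyclic, for the following reason. The quotient is spanned
  by the pairs of a bi-colouring and a non-dominating component \<open>X\<close>. The differential either keeps
  \<open>X\<close>, when the new vertex is not adjacent to \<open>X\<close>, or enlarges it. So the quotient is filtered
  by \<open>card X\<close>, and in the associated graded complex \<open>X\<close> is fixed and the other coloured vertices
  form an arbitrary subset of the complement of the closed neighbourhood of \<open>X\<close>. As
  \<open>X\<close> is not dominating, this complement is nonempty. Hence each summand is the signed cochain
  complex of a cube of positive dimension, which is contracted by switching off one chosen vertex
  \<open>w\<close> of the complement.

  The argument is carried out on chains. Acyclicity of the quotient says that a chain of the
  bold complex whose differential is dominating can be made dominating by subtracting a boundary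
  (\<open>push_into_dominating\<close>). This follows by removing the smallest non-dominating components
  repeatedly (\<open>clear_smallest_components\<close>), which uses the formula for the leading part of the
  differential (\<open>bold_diff_leading_coefficient\<close>). The passage from this property to homology is
  pure homological algebra (\<open>inclusion_quasi_isomorphism\<close>).
\<close>


section \<open>Finitely supported linear combinations\<close>

lemma lookup_scale_chain: "Poly_Mapping.lookup (scale_chain c p) g = c * Poly_Mapping.lookup p g"
  by (simp add: scale_chain_def Poly_Mapping.map.rep_eq when_def)

lemma keys_scale_chain: "Poly_Mapping.keys (scale_chain c p) \<subseteq> Poly_Mapping.keys p"
  by (auto simp: in_keys_iff lookup_scale_chain)

lemma lookup_extend_linearly:
  assumes "finite A" "Poly_Mapping.keys p \<subseteq> A"
  shows "Poly_Mapping.lookup (extend_linearly b p) h =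
    (\<Sum>g\<in>A. Poly_Mapping.lookup p g * Poly_Mapping.lookup (b g) h)"
proof -
  have "Poly_Mapping.lookup (extend_linearly b p) h =
      (\<Sum>g\<in>Poly_Mapping.keys p. Poly_Mapping.lookup p g * Poly_Mapping.lookup (b g) h)"
    by (simp add: extend_linearly_def lookup_sum lookup_scale_chain)
  also have "\<dots> = (\<Sum>g\<in>A. Poly_Mapping.lookup p g * Poly_Mapping.lookup (b g) h)"
    by (rule sum.mono_neutral_left) (use assms in \<open>auto simp: in_keys_iff\<close>)
  finally show ?thesis .
qed

lemma extend_linearly_add: "extend_linearly b (p + q) = extend_linearly b p + extend_linearly b q"
proof (rule poly_mapping_eqI)
  fix h
  let ?A = "Poly_Mapping.keys p \<union> Poly_Mapping.keys q"
  have "Poly_Mapping.keys (p + q) \<subseteq> ?A" by (rule keys_add)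
  then show "Poly_Mapping.lookup (extend_linearly b (p + q)) h =
      Poly_Mapping.lookup (extend_linearly b p + extend_linearly b q) h"
    by (simp add: lookup_extend_linearly[of ?A] lookup_add distrib_right sum.distrib)
qed

lemma extend_linearly_diff: "extend_linearly b (p - q) = extend_linearly b p - extend_linearly b q"
  by (metis extend_linearly_add add_diff_cancel diff_add_cancel)

lemma extend_linearly_scale:
  "extend_linearly b (scale_chain c p) = scale_chain c (extend_linearly b p)"
proof (rule poly_mapping_eqI)
  fix h
  show "Poly_Mapping.lookup (extend_linearly b (scale_chain c p)) h =
      Poly_Mapping.lookup (scale_chain c (extend_linearly b p)) h"
    by (simp add: lookup_extend_linearly[OF _ keys_scale_chain]
        lookup_extend_linearly[of "Poly_Mapping.keys p" p] lookup_scale_chain sum_distrib_left mult.assoc)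
qed

lemma keys_diff_subset:
  fixes p q :: "'g \<Rightarrow>\<^sub>0 'k::ab_group_add"
  shows "Poly_Mapping.keys (p - q) \<subseteq> Poly_Mapping.keys p \<union> Poly_Mapping.keys q"
  by (auto simp: in_keys_iff lookup_minus)

lemma supported_linear_subspace: "linear_subspace {p. Poly_Mapping.keys p \<subseteq> A}"
  using keys_add keys_scale_chain by (fastforce simp: linear_subspace_def)

lemma chain_complex_supported:
  fixes A :: "nat \<Rightarrow> 'g set" and b :: "'g \<Rightarrow> ('g \<Rightarrow>\<^sub>0 'k::field)"
  assumes "\<And>i p. Poly_Mapping.keys p \<subseteq> A i \<Longrightarrow>
             Poly_Mapping.keys (extend_linearly b p) \<subseteq> A (Suc i)"
    and "\<And>i p. Poly_Mapping.keys p \<subseteq> A i \<Longrightarrow> extend_linearly b (extend_linearly b p) = 0"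
  shows "chain_complex \<lparr>chains = \<lambda>i. {p. Poly_Mapping.keys p \<subseteq> A i}, diff = \<lambda>i. extend_linearly b\<rparr>"
  using assms
  by (simp add: chain_complex_def linear_between_def supported_linear_subspace
      extend_linearly_add extend_linearly_scale)


section \<open>Inclusions of subcomplexes\<close>

lemma linear_subspace_minus:
  assumes "linear_subspace U" "x \<in> U" "y \<in> U"
  shows "x - y \<in> U"
proof -
  have "scale_chain (- 1) y = - y"
    by (rule poly_mapping_eqI) (simp add: lookup_scale_chain)
  then have "- y \<in> U" using assms(1,3) unfolding linear_subspace_def by metis
  then have "x + - y \<in> U" using assms(1,2) unfolding linear_subspace_def by blast
  then show ?thesis by simp
qed

context
  fixes C :: "('g, 'k::field) cpx"
  assumes C: "chain_complex C"
begin

lemma chains_subspace: "linear_subspace (chains C i)"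
  using C by (simp add: chain_complex_def)

lemma diff_in_chains: "x \<in> chains C i \<Longrightarrow> diff C i x \<in> chains C (Suc i)"
  using C by (auto simp: chain_complex_def linear_between_def)

lemma cpx_diff_diff: "x \<in> chains C i \<Longrightarrow> diff C (Suc i) (diff C i x) = 0"
  using C by (auto simp: chain_complex_def)

lemma cpx_diff_add:
  "x \<in> chains C i \<Longrightarrow> y \<in> chains C i \<Longrightarrow> diff C i (x + y) = diff C i x + diff C i y"
  using C by (auto simp: chain_complex_def linear_between_def)

lemma cpx_diff_minus:
  assumes "x \<in> chains C i" "y \<in> chains C i"
  shows "diff C i (x - y) = diff C i x - diff C i y"
  using cpx_diff_add[of "x - y" i y] linear_subspace_minus[OF chains_subspace assms] assms
  by (simp add: algebra_simps)

lemma zero_in_chains: "0 \<in> chains C i"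
  using chains_subspace by (auto simp: linear_subspace_def)

lemma cpx_diff_zero: "diff C i 0 = 0"
  using cpx_diff_minus[OF zero_in_chains zero_in_chains] by simp

lemma boundaries_chains: "x \<in> boundaries C i \<Longrightarrow> x \<in> chains C i"
  using zero_in_chains diff_in_chains by (cases i) (auto simp: boundaries_def)

lemma diff_boundary: "x \<in> boundaries C i \<Longrightarrow> diff C i x = 0"
  using cpx_diff_zero cpx_diff_diff by (cases i) (auto simp: boundaries_def)

lemma boundaries_minus:
  assumes "x \<in> boundaries C i" "y \<in> boundaries C i"
  shows "x - y \<in> boundaries C i"
proof (cases i)
  case 0
  then show ?thesis using assms by (simp add: boundaries_def)
next
  case (Suc j)
  then obtain a b where "a \<in> chains C j" "b \<in> chains C j" "x = diff C j a" "y = diff C j b"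
    using assms by (auto simp: boundaries_def)
  then have "x - y = diff C j (a - b)" "a - b \<in> chains C j"
    using cpx_diff_minus linear_subspace_minus[OF chains_subspace] by auto
  then show ?thesis using Suc by (auto simp: boundaries_def)
qed

lemma zero_in_boundaries: "0 \<in> boundaries C i"
  using cpx_diff_zero zero_in_chains by (cases i) (auto simp: boundaries_def intro!: rev_image_eqI)

lemma equiv_homologous: "equiv (cycles C i) (homologous C i)"
proof (rule equivI)
  show "homologous C i \<subseteq> cycles C i \<times> cycles C i"
    by (auto simp: homologous_def)
  show "refl_on (cycles C i) (homologous C i)"
    using zero_in_boundaries by (auto simp: refl_on_def homologous_def)
  show "sym (homologous C i)"
  proof (rule symI)
    fix x y assume "(x, y) \<in> homologous C i"
    then show "(y, x) \<in> homologous C i"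
      using boundaries_minus[OF zero_in_boundaries, of "x - y" i] by (auto simp: homologous_def)
  qed
  show "trans (homologous C i)"
  proof (rule transI)
    fix x y z assume xy: "(x, y) \<in> homologous C i" and yz: "(y, z) \<in> homologous C i"
    have "z - y \<in> boundaries C i"
      using boundaries_minus[OF zero_in_boundaries, of "y - z" i] yz by (simp add: homologous_def)
    moreover have "x - y \<in> boundaries C i" using xy by (simp add: homologous_def)
    ultimately have "(x - y) - (z - y) \<in> boundaries C i" by (rule boundaries_minus[rotated])
    then show "(x, z) \<in> homologous C i"
      using xy yz by (simp add: homologous_def)
  qed
qed

end

text \<open>
  The hypothesis \<open>push\<close> says that the quotient complex \<open>C / D\<close> is acyclic: a chain of \<open>C\<close> that
  is a cycle modulo \<open>D\<close> is also a boundary modulo \<open>D\<close>. Applied to a cycle of \<open>C\<close> it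
  gives surjectivity on homology, applied to a chain of \<open>C\<close> that bounds a cycle of \<open>D\<close> it gives
  injectivity.
\<close>

lemma inclusion_quasi_isomorphism:
  fixes C D :: "('g, 'k::field) cpx"
  assumes C: "chain_complex C" and D: "chain_complex D"
    and sub: "\<And>i. chains D i \<subseteq> chains C i"
    and diff: "diff D = diff C"
    and push: "\<And>i c. c \<in> chains C i \<Longrightarrow> diff C i c \<in> chains D (Suc i) \<Longrightarrow>
                 \<exists>b\<in>boundaries C i. c - b \<in> chains D i"
  shows "quasi_isomorphism D C (\<lambda>i x. x)"
proof -
  have cyc: "cycles D i \<subseteq> cycles C i" for i
    using sub diff by (auto simp: cycles_def)
  have bnd: "boundaries D i \<subseteq> boundaries C i" for i
    using sub diff by (cases i) (auto simp: boundaries_def)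
  have map: "homology_map D C (\<lambda>i x. x) i (homologous D i `` {x}) = homologous C i `` {x}"
    if x: "x \<in> cycles D i" for i x
  proof -
    have "(x, y) \<in> homologous C i" if "(x, y) \<in> homologous D i" for y
      using that cyc bnd by (auto simp: homologous_def)
    moreover have "(x, x) \<in> homologous D i"
      using equiv_class_self[OF equiv_homologous[OF D] x] by auto
    ultimately show ?thesis
      unfolding homology_map_def
      using equiv_class_eq[OF equiv_homologous[OF C]] by blast
  qed
  have "bij_betw (homology_map D C (\<lambda>i x. x) i) (homology D i) (homology C i)" for i
  proof (rule bij_betw_imageI)
    show "inj_on (homology_map D C (\<lambda>i x. x) i) (homology D i)"
    proof (rule inj_onI)
      fix X Y
      assume "X \<in> homology D i" "Y \<in> homology D i"
        and eq: "homology_map D C (\<lambda>i x. x) i X = homology_map D C (\<lambda>i x. x) i Y"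
      then obtain x y where x: "x \<in> cycles D i" "X = homologous D i `` {x}"
        and y: "y \<in> cycles D i" "Y = homologous D i `` {y}"
        by (auto simp: homology_def elim!: quotientE)
      have "(x, y) \<in> homologous C i"
        using eq x y cyc eq_equiv_class[OF _ equiv_homologous[OF C]] map by (metis subsetD)
      then have b: "x - y \<in> boundaries C i" by (simp add: homologous_def)
      have xy: "x - y \<in> chains D i"
        using x y linear_subspace_minus[OF chains_subspace[OF D]] by (auto simp: cycles_def)
      have "x - y \<in> boundaries D i"
      proof (cases i)
        case 0
        then show ?thesis using b by (simp add: boundaries_def)
      next
        case (Suc j)
        then obtain a where a: "a \<in> chains C j" "x - y = diff C j a"
          using b by (auto simp: boundaries_def)
        then obtain e where e: "e \<in> boundaries C j" "a - e \<in> chains D j"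
          using push[of a j] xy Suc by auto
        have "diff C j (a - e) = x - y"
          using cpx_diff_minus[OF C a(1) boundaries_chains[OF C e(1)]] diff_boundary[OF C e(1)] a(2)
          by simp
        then show ?thesis using e(2) Suc diff by (auto simp: boundaries_def intro!: rev_image_eqI)
      qed
      then have "(x, y) \<in> homologous D i" using x y by (simp add: homologous_def)
      then show "X = Y" using equiv_class_eq[OF equiv_homologous[OF D]] x y by blast
    qed
    show "homology_map D C (\<lambda>i x. x) i ` homology D i = homology C i"
    proof (intro equalityI subsetI)
      fix Z assume "Z \<in> homology_map D C (\<lambda>i x. x) i ` homology D i"
      then obtain x where "x \<in> cycles D i" "Z = homologous C i `` {x}"
        using map by (auto simp: homology_def elim!: quotientE)
      then show "Z \<in> homology C i" using cyc by (auto simp: homology_def intro!: quotientI)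
    next
      fix Z assume "Z \<in> homology C i"
      then obtain z where z: "z \<in> cycles C i" "Z = homologous C i `` {z}"
        by (auto simp: homology_def elim!: quotientE)
      then have "z \<in> chains C i" "diff C i z = 0" by (auto simp: cycles_def)
      then obtain e where e: "e \<in> boundaries C i" "z - e \<in> chains D i"
        using push[of z i] zero_in_chains[OF D] by auto
      have "diff C i (z - e) = 0"
        using cpx_diff_minus[OF C \<open>z \<in> chains C i\<close> boundaries_chains[OF C e(1)]]
          diff_boundary[OF C e(1)] \<open>diff C i z = 0\<close> by simp
      then have ze: "z - e \<in> cycles D i" using e(2) diff by (simp add: cycles_def)
      then have "(z, z - e) \<in> homologous C i" using z e cyc by (auto simp: homologous_def)
      then have "Z = homology_map D C (\<lambda>i x. x) i (homologous D i `` {z - e})"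
        using equiv_class_eq[OF equiv_homologous[OF C]] z map[OF ze] by metis
      moreover have "homologous D i `` {z - e} \<in> homology D i"
        unfolding homology_def by (rule quotientI[OF ze])
      ultimately show "Z \<in> homology_map D C (\<lambda>i x. x) i ` homology D i" by blast
    qed
  qed
  moreover have "chain_map D C (\<lambda>i x. x)"
    using sub diff by (auto simp: chain_map_def linear_between_def)
  ultimately show ?thesis using C D by (simp add: quasi_isomorphism_def)
qed


section \<open>Components of induced subgraphs\<close>

text \<open>
  Connectedness of \<open>X\<close> is expressed inside \<open>G \<restriction> X\<close>, so that \<open>S\<close> enters only through \<open>X \<subseteq> S\<close> and
  the absence of edges from \<open>X\<close> to \<open>S - X\<close>. In this form it is visible that \<open>X\<close> stays a component
  when vertices outside its closed neighbourhood are added to \<open>S\<close> or removed from it.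
\<close>

lemma in_components_iff:
  assumes "graph G" "S \<subseteq> verts G"
  shows "X \<in> components (G \<restriction> S) \<longleftrightarrow>
    X \<noteq> {} \<and> X \<subseteq> S \<and> (\<forall>u\<in>X. \<forall>v\<in>X. u \<rightarrow>\<^sup>*\<^bsub>G \<restriction> X\<^esub> v) \<and>
    (\<forall>u\<in>X. \<forall>v\<in>S - X. \<not> u \<rightarrow>\<^bsub>G\<^esub> v)"
    (is "_ \<longleftrightarrow> ?R")
proof -
  interpret graph G by fact
  interpret H: wf_digraph "G \<restriction> S" by auto
  have sym: "symmetric (G \<restriction> S)"
    using assms(2) by (intro induced_graph_imp_symmetric[OF sym_arcs] induced_induce)
  have edge: "u \<rightarrow>\<^bsub>G \<restriction> S\<^esub> v \<longleftrightarrow> u \<in> S \<and> v \<in> S \<and> u \<rightarrow>\<^bsub>G\<^esub> v" for u v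
    by (auto simp: arcs_ends_conv intro!: rev_image_eqI)
  show ?thesis
  proof
    assume X: "X \<in> components (G \<restriction> S)"
    then interpret M: max_reachable_set "G \<restriction> S" X
      by unfold_locales (simp add: components_def)
    have "X \<noteq> {}" using X by (simp add: components_def pre_digraph.sccs_verts_def)
    moreover have XS: "X \<subseteq> S"
      using M.reach_in H.reachable_in_verts by fastforce
    moreover have "(G \<restriction> S) \<restriction> X = G \<restriction> X"
      using XS by (auto simp: induce_subgraph_def)
    then have "\<forall>u\<in>X. \<forall>v\<in>X. u \<rightarrow>\<^sup>*\<^bsub>G \<restriction> X\<^esub> v"
      using M.reachable_induced M.reach_in by metis
    moreover have "\<not> u \<rightarrow>\<^bsub>G\<^esub> v" if "u \<in> X" "v \<in> S - X" for u v
    proof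
      assume "u \<rightarrow>\<^bsub>G\<^esub> v"
      then have uv: "u \<rightarrow>\<^sup>*\<^bsub>G \<restriction> S\<^esub> v" using that XS edge by (intro H.reachable_adjI) auto
      with symmetric_reachable[OF sym uv] M.not_reach_out[of u v] that show False by blast
    qed
    ultimately show ?R by blast
  next
    assume R: ?R
    have "v \<in> X" if "u \<rightarrow>\<^sup>*\<^bsub>G \<restriction> S\<^esub> v" "u \<in> X" for u v
      using that by (induction rule: H.reachable_induct) (use R edge in blast)+
    moreover have "u \<rightarrow>\<^sup>*\<^bsub>G \<restriction> S\<^esub> v" if "u \<in> X" "v \<in> X" for u v
      using R that reachable_induce_ss by blast
    ultimately show "X \<in> components (G \<restriction> S)"
      using R unfolding components_def pre_digraph.sccs_verts_def by blast
  qed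
qed

lemma components_nonempty: "X \<in> components H \<Longrightarrow> X \<noteq> {}"
  by (simp add: components_def pre_digraph.sccs_verts_def)

lemma components_unique:
  assumes "graph G" "X \<noteq> {}"
    and "Y \<in> components (coloured_subgraph G \<epsilon>)" "X \<subseteq> Y"
    and "Z \<in> components (coloured_subgraph G \<epsilon>)" "X \<subseteq> Z"
  shows "Y = Z"
proof -
  interpret graph G by fact
  interpret H: wf_digraph "coloured_subgraph G \<epsilon>" by (auto simp: coloured_subgraph_def)
  show ?thesis
    using H.sccs_verts_disjoint[of Y Z] assms by (auto simp: components_def)
qed

lemma flip_up_component_exists:
  assumes "graph G" "flip_up G \<epsilon> \<epsilon>'" "X \<in> components (coloured_subgraph G \<epsilon>)"
  obtains Y where "Y \<in> components (coloured_subgraph G \<epsilon>')" "X \<subseteq> Y"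
proof -
  interpret graph G by fact
  define S where "S = {v \<in> verts G. \<epsilon> v = 1}"
  define S' where "S' = {v \<in> verts G. \<epsilon>' v = 1}"
  interpret H: wf_digraph "G \<restriction> S'" by auto
  have "S' \<subseteq> verts G" "S \<subseteq> S'" using assms(2) by (auto simp: S_def S'_def flip_up_def)
  have sym: "symmetric (G \<restriction> S')"
    using \<open>S' \<subseteq> verts G\<close> by (intro induced_graph_imp_symmetric[OF sym_arcs] induced_induce)
  from assms(3) have X: "X \<noteq> {}" "\<And>u v. u \<in> X \<Longrightarrow> v \<in> X \<Longrightarrow> u \<rightarrow>\<^sup>*\<^bsub>G \<restriction> S\<^esub> v"
    by (auto simp: components_def pre_digraph.sccs_verts_def coloured_subgraph_def S_def)
  then obtain x where x: "x \<in> X" by blast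
  define Y where "Y = {v. x \<rightarrow>\<^sup>*\<^bsub>G \<restriction> S'\<^esub> v}"
  have XY: "X \<subseteq> Y"
    using X(2)[OF x] reachable_induce_ss[OF _ \<open>S \<subseteq> S'\<close>] by (auto simp: Y_def)
  have "u \<rightarrow>\<^sup>*\<^bsub>G \<restriction> S'\<^esub> v" if "u \<in> Y" "v \<in> Y" for u v
    using that symmetric_reachable[OF sym, of x u] H.reachable_trans[of u x v] by (simp add: Y_def)
  moreover have "\<not> u \<rightarrow>\<^sup>*\<^bsub>G \<restriction> S'\<^esub> v" if "u \<in> Y" "v \<notin> Y" for u v
    using that H.reachable_trans[of x u v] by (auto simp: Y_def)
  ultimately have "Y \<in> components (coloured_subgraph G \<epsilon>')"
    using x XY by (auto simp: components_def pre_digraph.sccs_verts_def coloured_subgraph_def S'_def)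
  then show ?thesis using XY that by blast
qed

lemma component_subset:
  assumes "graph G" "X \<in> components (coloured_subgraph G \<epsilon>)"
  shows "X \<subseteq> {v \<in> verts G. \<epsilon> v = 1}"
  using assms in_components_iff[of G "{v \<in> verts G. \<epsilon> v = 1}" X]
  by (simp add: coloured_subgraph_def)

lemma component_flip_nonadjacent:
  assumes "graph G" "w \<in> verts G" "w \<notin> X" "\<And>u. u \<in> X \<Longrightarrow> \<not> u \<rightarrow>\<^bsub>G\<^esub> w"
  shows "X \<in> components (coloured_subgraph G (\<epsilon>(w := c))) \<longleftrightarrow>
    X \<in> components (coloured_subgraph G \<epsilon>)"
proof -
  let ?S = "\<lambda>\<epsilon>. {v \<in> verts G. \<epsilon> v = 1}"
  have "?S (\<epsilon>(w := c)) - {w} = ?S \<epsilon> - {w}" by auto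
  then have "X \<subseteq> ?S (\<epsilon>(w := c)) \<longleftrightarrow> X \<subseteq> ?S \<epsilon>"
    and "\<And>u. u \<in> X \<Longrightarrow> (\<forall>v\<in>?S (\<epsilon>(w := c)) - X. \<not> u \<rightarrow>\<^bsub>G\<^esub> v) \<longleftrightarrow> (\<forall>v\<in>?S \<epsilon> - X. \<not> u \<rightarrow>\<^bsub>G\<^esub> v)"
    using assms(3,4) by (blast, blast)
  then show ?thesis
    unfolding coloured_subgraph_def
    by (subst (1 2) in_components_iff[OF assms(1)]) auto
qed


section \<open>The bold differential\<close>

abbreviation bold_diff ::
    "('a, 'b) pre_digraph \<Rightarrow> (('a \<Rightarrow> nat) \<Rightarrow> ('a \<Rightarrow> nat) \<Rightarrow> bit) \<Rightarrow>
     ('a bold_gen \<Rightarrow>\<^sub>0 'k::field) \<Rightarrow> ('a bold_gen \<Rightarrow>\<^sub>0 'k)" where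
  "bold_diff G s \<equiv> extend_linearly (bold_diff_gen G s)"

text \<open>The colour values are the numerals \<open>0\<close> and \<open>1\<close>; rewriting \<open>1\<close> to \<open>Suc 0\<close> would hide them.\<close>

declare One_nat_def [simp del]

lemma bicolouring_upd:
  "\<epsilon> \<in> bicolourings G \<Longrightarrow> v \<in> verts G \<Longrightarrow> c \<in> {0, 1} \<Longrightarrow> \<epsilon>(v := c) \<in> bicolourings G"
  by (auto simp: bicolourings_def PiE_def extensional_def Pi_def)

lemma flip_up_raise:
  "\<epsilon> \<in> bicolourings G \<Longrightarrow> v \<in> verts G \<Longrightarrow> \<epsilon> v = 0 \<Longrightarrow> flip_up G \<epsilon> (\<epsilon>(v := 1))"
  by (auto simp: flip_up_def)

lemma flip_up_lower:
  assumes "\<epsilon> \<in> bicolourings G" "v \<in> verts G" "\<epsilon> v = 1"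
  shows "flip_up G (\<epsilon>(v := 0)) \<epsilon>"
  using flip_up_raise[OF bicolouring_upd[OF assms(1,2), of 0] assms(2)] assms(3) by (simp add: fun_upd_idem)

lemma flip_up_bicolouring: "flip_up G \<epsilon> \<epsilon>' \<Longrightarrow> \<epsilon>' \<in> bicolourings G"
  using bicolouring_upd by (fastforce simp: flip_up_def)

lemma flip_up_sum:
  assumes "graph G" "flip_up G \<epsilon> \<epsilon>'"
  shows "(\<Sum>v\<in>verts G. \<epsilon>' v) = Suc (\<Sum>v\<in>verts G. \<epsilon> v)"
proof -
  interpret graph G by fact
  from assms(2) obtain w where w: "w \<in> verts G" "\<epsilon> w = 0" "\<epsilon>' = \<epsilon>(w := 1)"
    by (auto simp: flip_up_def)
  have "(\<Sum>v\<in>verts G - {w}. \<epsilon>' v) = (\<Sum>v\<in>verts G - {w}. \<epsilon> v)"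
    by (rule sum.cong) (use w in auto)
  then show ?thesis
    using w by (simp add: sum.remove[OF finite_verts w(1)])
qed

lemma finite_bicolourings: "graph G \<Longrightarrow> finite (bicolourings G)"
proof -
  assume "graph G"
  then interpret graph G .
  show ?thesis unfolding bicolourings_def by (intro finite_PiE) auto
qed

lemma finite_coloured_components:
  assumes "graph G"
  shows "finite {(\<epsilon>, X). \<epsilon> \<in> bicolourings G \<and> X \<in> components (coloured_subgraph G \<epsilon>)}"
proof -
  interpret graph G by fact
  have "{(\<epsilon>, X). \<epsilon> \<in> bicolourings G \<and> X \<in> components (coloured_subgraph G \<epsilon>)} \<subseteq>
      bicolourings G \<times> Pow (verts G)"
    using component_subset[OF assms] by blast
  then show ?thesis
    by (rule finite_subset) (simp add: finite_bicolourings[OF assms])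
qed

lemma finite_bold_gens: "graph G \<Longrightarrow> finite (bold_gens G i)"
  by (rule finite_subset[OF _ finite_coloured_components]) (auto simp: bold_gens_def)

lemma lookup_bold_diff_gen:
  assumes "graph G"
  shows "Poly_Mapping.lookup (bold_diff_gen G s (\<epsilon>, X) :: _ \<Rightarrow>\<^sub>0 'k::field) (\<epsilon>', Y) =
    (if flip_up G \<epsilon> \<epsilon>' \<and> Y \<in> components (coloured_subgraph G \<epsilon>') \<and> X \<subseteq> Y
     then sign_of_bit (s \<epsilon> \<epsilon>') else 0)"
proof -
  let ?I = "{(\<epsilon>', Y). flip_up G \<epsilon> \<epsilon>' \<and> Y \<in> components (coloured_subgraph G \<epsilon>') \<and> X \<subseteq> Y}"
  have "?I \<subseteq> {(\<epsilon>, X). \<epsilon> \<in> bicolourings G \<and> X \<in> components (coloured_subgraph G \<epsilon>)}"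
    using flip_up_bicolouring by blast
  then have fin: "finite ?I"
    by (rule finite_subset) (rule finite_coloured_components[OF assms])
  have "Poly_Mapping.lookup (bold_diff_gen G s (\<epsilon>, X)) (\<epsilon>', Y) =
      (\<Sum>g\<in>?I. if g = (\<epsilon>', Y) then sign_of_bit (s \<epsilon> \<epsilon>') else 0 :: 'k)"
    by (auto simp: bold_diff_gen_def lookup_sum lookup_single when_def intro!: sum.cong)
  also have "\<dots> = (if (\<epsilon>', Y) \<in> ?I then sign_of_bit (s \<epsilon> \<epsilon>') else 0)"
    using fin by (rule sum.delta)
  finally show ?thesis by simp
qed

lemma bold_gens_flip:
  assumes "graph G" "(\<epsilon>, X) \<in> bold_gens G i" "flip_up G \<epsilon> \<epsilon>'"
    and "Y \<in> components (coloured_subgraph G \<epsilon>')"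
  shows "(\<epsilon>', Y) \<in> bold_gens G (Suc i)"
  using assms flip_up_bicolouring flip_up_sum[OF assms(1,3)] by (auto simp: bold_gens_def)

lemma keys_bold_diffE:
  assumes G: "graph G" and "(\<epsilon>', Y) \<in> Poly_Mapping.keys (bold_diff G s p :: _ \<Rightarrow>\<^sub>0 'k::field)"
  obtains \<epsilon> X where "(\<epsilon>, X) \<in> Poly_Mapping.keys p" "flip_up G \<epsilon> \<epsilon>'"
    "Y \<in> components (coloured_subgraph G \<epsilon>')" "X \<subseteq> Y"
proof -
  have "(\<Sum>g\<in>Poly_Mapping.keys p. Poly_Mapping.lookup p g *
      Poly_Mapping.lookup (bold_diff_gen G s g) (\<epsilon>', Y)) \<noteq> 0"
    using assms(2) by (simp add: in_keys_iff lookup_extend_linearly[of "Poly_Mapping.keys p" p])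
  then obtain g where "g \<in> Poly_Mapping.keys p"
    "Poly_Mapping.lookup (bold_diff_gen G s g :: _ \<Rightarrow>\<^sub>0 'k) (\<epsilon>', Y) \<noteq> 0"
    by (metis (no_types, lifting) mult_zero_right sum.not_neutral_contains_not_neutral)
  moreover obtain \<epsilon> X where "g = (\<epsilon>, X)" by (cases g)
  ultimately show ?thesis
    using that[of \<epsilon> X] by (simp add: lookup_bold_diff_gen[OF G] split: if_splits)
qed

lemma bold_diff_keys:
  assumes "graph G" "Poly_Mapping.keys p \<subseteq> bold_gens G i"
  shows "Poly_Mapping.keys (bold_diff G s p) \<subseteq> bold_gens G (Suc i)"
proof (rule subrelI)
  fix \<epsilon>' Y assume "(\<epsilon>', Y) \<in> Poly_Mapping.keys (bold_diff G s p)"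
  then obtain \<epsilon> X where "(\<epsilon>, X) \<in> Poly_Mapping.keys p" "flip_up G \<epsilon> \<epsilon>'"
      "Y \<in> components (coloured_subgraph G \<epsilon>')"
    by (rule keys_bold_diffE[OF assms(1)])
  then show "(\<epsilon>', Y) \<in> bold_gens G (Suc i)"
    using assms(2) bold_gens_flip[OF assms(1)] by blast
qed

lemma dominating_set_mono:
  "dominating_set G X \<Longrightarrow> X \<subseteq> Y \<Longrightarrow> Y \<subseteq> verts G \<Longrightarrow> dominating_set G Y"
  unfolding dominating_set_def by blast

lemma dominating_diff_keys:
  assumes "graph G" "Poly_Mapping.keys p \<subseteq> dominating_gens G i"
  shows "Poly_Mapping.keys (bold_diff G s p) \<subseteq> dominating_gens G (Suc i)"
proof (rule subrelI)
  fix \<epsilon>' Y assume k: "(\<epsilon>', Y) \<in> Poly_Mapping.keys (bold_diff G s p)"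
  obtain \<epsilon> X where X: "(\<epsilon>, X) \<in> Poly_Mapping.keys p" "X \<subseteq> Y"
      and Y: "Y \<in> components (coloured_subgraph G \<epsilon>')"
    using k by (rule keys_bold_diffE[OF assms(1)])
  have "Y \<subseteq> verts G" using component_subset[OF assms(1) Y] by blast
  moreover have "dominating_set G X" using X(1) assms(2) by (auto simp: dominating_gens_def)
  ultimately have "dominating_set G Y" using dominating_set_mono X(2) by blast
  moreover have "Poly_Mapping.keys p \<subseteq> bold_gens G i"
    using assms(2) by (auto simp: dominating_gens_def)
  then have "(\<epsilon>', Y) \<in> bold_gens G (Suc i)"
    using bold_diff_keys[OF assms(1)] k by blast
  ultimately show "(\<epsilon>', Y) \<in> dominating_gens G (Suc i)" by (simp add: dominating_gens_def)
qed

lemma sign_of_bit_square: "sign_of_bit b * sign_of_bit b = (1 :: 'k::field)"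
  by (simp add: sign_of_bit_def)

lemma sign_of_bit_add: "sign_of_bit (a + b) = (sign_of_bit a * sign_of_bit b :: 'k::field)"
  by (cases a; cases b) (simp_all add: sign_of_bit_def)

lemma sign_anticommute:
  assumes "sign_assignment G s" "\<epsilon> \<in> bicolourings G" "v \<in> verts G" "w \<in> verts G" "v \<noteq> w"
    and "\<epsilon> v = 0" "\<epsilon> w = 0"
  shows "sign_of_bit (s \<epsilon> (\<epsilon>(v := 1))) * sign_of_bit (s (\<epsilon>(v := 1)) (\<epsilon>(v := 1, w := 1))) =
    - (sign_of_bit (s \<epsilon> (\<epsilon>(w := 1))) * sign_of_bit (s (\<epsilon>(w := 1)) (\<epsilon>(v := 1, w := 1))) :: 'k::field)"
proof -
  have upd: "\<epsilon>(v := 1, w := 1) = \<epsilon>(w := 1, v := 1)" using assms(5) by (rule fun_upd_twist)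
  have "flip_up G \<epsilon> (\<epsilon>(v := 1))" "flip_up G \<epsilon> (\<epsilon>(w := 1))"
    using assms by (auto intro: flip_up_raise)
  moreover have "flip_up G (\<epsilon>(v := 1)) (\<epsilon>(v := 1, w := 1))"
    using assms by (intro flip_up_raise bicolouring_upd) auto
  moreover have "flip_up G (\<epsilon>(w := 1)) (\<epsilon>(v := 1, w := 1))"
    unfolding upd using assms by (intro flip_up_raise bicolouring_upd) auto
  moreover have "\<epsilon>(v := 1) \<noteq> \<epsilon>(w := 1)"
    using assms(5,6) by (metis fun_upd_apply zero_neq_one)
  ultimately have "s \<epsilon> (\<epsilon>(v := 1)) + s (\<epsilon>(v := 1)) (\<epsilon>(v := 1, w := 1)) =
      s \<epsilon> (\<epsilon>(w := 1)) + s (\<epsilon>(w := 1)) (\<epsilon>(v := 1, w := 1)) + 1"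
    using assms(1) unfolding sign_assignment_def by blast
  then have "sign_of_bit (s \<epsilon> (\<epsilon>(v := 1)) + s (\<epsilon>(v := 1)) (\<epsilon>(v := 1, w := 1))) =
      (sign_of_bit (s \<epsilon> (\<epsilon>(w := 1)) + s (\<epsilon>(w := 1)) (\<epsilon>(v := 1, w := 1)) + 1) :: 'k)"
    by (rule arg_cong)
  then show ?thesis
    unfolding sign_of_bit_add by (simp add: sign_of_bit_def[of 1])
qed

text \<open>
  Between two bi-colourings that differ in two vertices there are exactly two intermediate ones.
  For each of them the component containing \<open>X\<close> is unique, so at most two terms are
  nonzero, and these cancel by the sign rule.
\<close>

lemma bold_diff_gen_diff:
  assumes G: "graph G" and s: "sign_assignment G s" and g: "(\<epsilon>, X) \<in> bold_gens G i"
  shows "(\<Sum>g\<in>bold_gens G (Suc i). Poly_Mapping.lookup (bold_diff_gen G s (\<epsilon>, X)) g *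
    Poly_Mapping.lookup (bold_diff_gen G s g) h) = (0 :: 'k::field)"
    (is "sum ?F _ = 0")
proof (cases "\<exists>g\<in>bold_gens G (Suc i). ?F g \<noteq> 0")
  case False
  then show ?thesis by (intro sum.neutral) blast
next
  case True
  obtain \<epsilon>'' Z where h: "h = (\<epsilon>'', Z)" by (cases h)
  have F: "?F (\<delta>, Y) = (if flip_up G \<epsilon> \<delta> \<and> Y \<in> components (coloured_subgraph G \<delta>) \<and> X \<subseteq> Y \<and>
      flip_up G \<delta> \<epsilon>'' \<and> Z \<in> components (coloured_subgraph G \<epsilon>'') \<and> Y \<subseteq> Z
      then sign_of_bit (s \<epsilon> \<delta>) * sign_of_bit (s \<delta> \<epsilon>'') else 0)" for \<delta> Y
    by (simp add: lookup_bold_diff_gen[OF G] h)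
  from True obtain \<epsilon>\<^sub>1 Y\<^sub>1 where g1: "(\<epsilon>\<^sub>1, Y\<^sub>1) \<in> bold_gens G (Suc i)" "?F (\<epsilon>\<^sub>1, Y\<^sub>1) \<noteq> 0"
    by auto
  then have 1: "flip_up G \<epsilon> \<epsilon>\<^sub>1" "Y\<^sub>1 \<in> components (coloured_subgraph G \<epsilon>\<^sub>1)" "X \<subseteq> Y\<^sub>1"
      "flip_up G \<epsilon>\<^sub>1 \<epsilon>''" and Z: "Z \<in> components (coloured_subgraph G \<epsilon>'')" "Y\<^sub>1 \<subseteq> Z"
    unfolding F by (simp_all split: if_splits)
  from 1(1) obtain v where v: "v \<in> verts G" "\<epsilon> v = 0" "\<epsilon>\<^sub>1 = \<epsilon>(v := 1)" and \<epsilon>: "\<epsilon> \<in> bicolourings G"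
    by (auto simp: flip_up_def)
  from 1(4) obtain w where w: "w \<in> verts G" "\<epsilon>\<^sub>1 w = 0" "\<epsilon>'' = \<epsilon>\<^sub>1(w := 1)"
    by (auto simp: flip_up_def)
  have vw: "v \<noteq> w" "\<epsilon> w = 0" using v w by (auto split: if_splits)
  have \<epsilon>'': "\<epsilon>'' = \<epsilon>(v := 1, w := 1)" using v w by simp
  define \<epsilon>\<^sub>2 where "\<epsilon>\<^sub>2 = \<epsilon>(w := 1)"
  have fl2: "flip_up G \<epsilon> \<epsilon>\<^sub>2" unfolding \<epsilon>\<^sub>2_def using \<epsilon> w(1) vw(2) by (rule flip_up_raise)
  have "flip_up G \<epsilon>\<^sub>2 (\<epsilon>\<^sub>2(v := 1))"
    using flip_up_bicolouring[OF fl2] v vw by (intro flip_up_raise) (auto simp: \<epsilon>\<^sub>2_def)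
  then have fl2': "flip_up G \<epsilon>\<^sub>2 \<epsilon>''"
    using \<epsilon>'' fun_upd_twist[OF vw(1), of \<epsilon> 1 1] by (simp add: \<epsilon>\<^sub>2_def)
  have X: "X \<in> components (coloured_subgraph G \<epsilon>)" using g by (simp add: bold_gens_def)
  note Xne = components_nonempty[OF X]
  obtain Y\<^sub>2 where Y2: "Y\<^sub>2 \<in> components (coloured_subgraph G \<epsilon>\<^sub>2)" "X \<subseteq> Y\<^sub>2"
    using flip_up_component_exists[OF G fl2 X] .
  obtain Z' where Z': "Z' \<in> components (coloured_subgraph G \<epsilon>'')" "Y\<^sub>2 \<subseteq> Z'"
    using flip_up_component_exists[OF G fl2' Y2(1)] .
  have "Z' = Z" using components_unique[OF G Xne Z'(1) _ Z(1)] Z' Z 1 Y2 by blast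
  have ne: "\<epsilon>\<^sub>1 \<noteq> \<epsilon>\<^sub>2" using v vw by (auto simp: \<epsilon>\<^sub>2_def fun_eq_iff)
  have g2: "(\<epsilon>\<^sub>2, Y\<^sub>2) \<in> bold_gens G (Suc i)" using bold_gens_flip[OF G g fl2 Y2(1)] .
  have other: "?F (\<delta>, Y) = 0" if "(\<delta>, Y) \<notin> {(\<epsilon>\<^sub>1, Y\<^sub>1), (\<epsilon>\<^sub>2, Y\<^sub>2)}" for \<delta> Y
  proof (rule ccontr)
    assume "?F (\<delta>, Y) \<noteq> 0"
    then have \<delta>: "flip_up G \<epsilon> \<delta>" "Y \<in> components (coloured_subgraph G \<delta>)" "X \<subseteq> Y" "flip_up G \<delta> \<epsilon>''"
      unfolding F by (simp_all split: if_splits)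
    then obtain u t where u: "\<epsilon> u = 0" "\<delta> = \<epsilon>(u := 1)" and t: "\<epsilon>'' = \<delta>(t := 1)"
      by (auto simp: flip_up_def)
    have "\<epsilon>'' u = 1" using u t by simp
    then have "u = v \<or> u = w" using \<epsilon>'' u(1) by (auto split: if_splits)
    then have "\<delta> = \<epsilon>\<^sub>1 \<or> \<delta> = \<epsilon>\<^sub>2" using u v \<epsilon>\<^sub>2_def by auto
    then show False
      using that \<delta> components_unique[OF G Xne \<delta>(2,3)] 1(2,3) Y2 by blast
  qed
  have "sum ?F (bold_gens G (Suc i)) = sum ?F {(\<epsilon>\<^sub>1, Y\<^sub>1), (\<epsilon>\<^sub>2, Y\<^sub>2)}"
  proof (rule sum.mono_neutral_right[OF finite_bold_gens[OF G]])
    show "\<forall>g\<in>bold_gens G (Suc i) - {(\<epsilon>\<^sub>1, Y\<^sub>1), (\<epsilon>\<^sub>2, Y\<^sub>2)}. ?F g = 0"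
      using other by (metis DiffD2 surj_pair)
  qed (use g1(1) g2 in simp)
  also have "\<dots> = ?F (\<epsilon>\<^sub>1, Y\<^sub>1) + ?F (\<epsilon>\<^sub>2, Y\<^sub>2)"
    using ne by (subst sum.insert) auto
  also have "\<dots> = sign_of_bit (s \<epsilon> \<epsilon>\<^sub>1) * sign_of_bit (s \<epsilon>\<^sub>1 \<epsilon>'') +
      sign_of_bit (s \<epsilon> \<epsilon>\<^sub>2) * sign_of_bit (s \<epsilon>\<^sub>2 \<epsilon>'')"
    unfolding F using 1 Z Y2 Z' \<open>Z' = Z\<close> fl2 fl2' by simp
  also have "\<dots> = 0"
    using sign_anticommute[OF s \<epsilon> v(1) w(1) vw(1) v(2) vw(2), where 'k = 'k]
    by (simp only: v(3) \<epsilon>\<^sub>2_def \<epsilon>'') simp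
  finally show ?thesis .
qed

lemma bold_diff_diff:
  fixes p :: "'a bold_gen \<Rightarrow>\<^sub>0 'k::field"
  assumes G: "graph G" and s: "sign_assignment G s" and p: "Poly_Mapping.keys p \<subseteq> bold_gens G i"
  shows "bold_diff G s (bold_diff G s p) = 0"
proof (rule poly_mapping_eqI)
  fix h
  let ?D = "\<lambda>g. Poly_Mapping.lookup (bold_diff_gen G s g :: _ \<Rightarrow>\<^sub>0 'k)"
  note fin = finite_bold_gens[OF G]
  have "Poly_Mapping.lookup (bold_diff G s (bold_diff G s p)) h =
      (\<Sum>g'\<in>bold_gens G (Suc i). (\<Sum>g\<in>bold_gens G i. Poly_Mapping.lookup p g * ?D g g') * ?D g' h)"
    by (simp add: lookup_extend_linearly[OF fin bold_diff_keys[OF G p]] lookup_extend_linearly[OF fin p])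
  also have "\<dots> = (\<Sum>g\<in>bold_gens G i. Poly_Mapping.lookup p g *
      (\<Sum>g'\<in>bold_gens G (Suc i). ?D g g' * ?D g' h))"
    by (simp add: sum_distrib_left sum_distrib_right mult.assoc)
      (rule sum.swap)
  also have "\<dots> = 0"
  proof (rule sum.neutral, rule ballI)
    fix g assume g: "g \<in> bold_gens G i"
    obtain \<epsilon> X where gX: "g = (\<epsilon>, X)" by (cases g)
    show "Poly_Mapping.lookup p g * (\<Sum>g'\<in>bold_gens G (Suc i). ?D g g' * ?D g' h) = 0"
      using bold_diff_gen_diff[OF G s g[unfolded gX], of h, where 'k = 'k] by (simp add: gX)
  qed
  finally show "Poly_Mapping.lookup (bold_diff G s (bold_diff G s p)) h = Poly_Mapping.lookup 0 h"
    by simp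
qed

lemma chain_complex_bold:
  assumes "graph G" "sign_assignment G s"
  shows "chain_complex (bold_complex G s :: ('a bold_gen, 'k::field) cpx)"
  unfolding bold_complex_def
  by (intro chain_complex_supported bold_diff_keys bold_diff_diff assms)

lemma chain_complex_dominating:
  assumes "graph G" "sign_assignment G s"
  shows "chain_complex (dominating_complex G s :: ('a bold_gen, 'k::field) cpx)"
  unfolding dominating_complex_def bold_complex_def cpx.simps
proof (rule chain_complex_supported)
  fix i and p :: "'a bold_gen \<Rightarrow>\<^sub>0 'k"
  assume p: "Poly_Mapping.keys p \<subseteq> dominating_gens G i"
  then show "Poly_Mapping.keys (bold_diff G s p) \<subseteq> dominating_gens G (Suc i)"
    by (rule dominating_diff_keys[OF assms(1)])
  have "dominating_gens G i \<subseteq> bold_gens G i" by (auto simp: dominating_gens_def)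
  then show "bold_diff G s (bold_diff G s p) = 0"
    using bold_diff_diff[OF assms] p by blast
qed


section \<open>Removing non-dominating components\<close>

text \<open>
  Filter the bold complex modulo the dominating generators by the size of the component. In the
  associated graded complex the component \<open>Y\<close> is fixed, and the differential only adds vertices
  outside the closed neighbourhood of \<open>Y\<close>. The lemma computes this leading part of the
  differential at a component of the smallest size that occurs.
\<close>

lemma bold_diff_leading_coefficient:
  fixes p :: "'a bold_gen \<Rightarrow>\<^sub>0 'k::field"
  assumes G: "graph G" and p: "Poly_Mapping.keys p \<subseteq> bold_gens G i"
    and min: "\<And>\<epsilon> X. (\<epsilon>, X) \<in> Poly_Mapping.keys p \<Longrightarrow> dominating_set G X \<or> card Y \<le> card X"
    and Y: "\<epsilon>' \<in> bicolourings G" "Y \<in> components (coloured_subgraph G \<epsilon>')" "\<not> dominating_set G Y"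
  shows "Poly_Mapping.lookup (bold_diff G s p) (\<epsilon>', Y) =
    (\<Sum>v\<in>{v \<in> verts G. \<epsilon>' v = 1} - Y.
       sign_of_bit (s (\<epsilon>'(v := 0)) \<epsilon>') * Poly_Mapping.lookup p (\<epsilon>'(v := 0), Y))"
proof -
  interpret graph G by fact
  let ?V = "{v \<in> verts G. \<epsilon>' v = 1} - Y" and ?h = "\<lambda>v. (\<epsilon>'(v := 0), Y)"
  let ?f = "\<lambda>g. Poly_Mapping.lookup p g * Poly_Mapping.lookup (bold_diff_gen G s g) (\<epsilon>', Y)"
  have Yverts: "Y \<subseteq> verts G" using component_subset[OF G Y(2)] by blast
  have fin: "finite (Poly_Mapping.keys p \<union> ?h ` ?V)" by simp
  have zero: "?f g = 0" if g: "g \<in> Poly_Mapping.keys p" "g \<notin> ?h ` ?V" for g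
  proof (rule ccontr)
    assume nz: "?f g \<noteq> 0"
    obtain \<epsilon> X where gX: "g = (\<epsilon>, X)" by (cases g)
    with nz have X: "flip_up G \<epsilon> \<epsilon>'" "X \<subseteq> Y"
      by (auto simp: lookup_bold_diff_gen[OF G] split: if_splits)
    have "\<not> dominating_set G X" using dominating_set_mono[OF _ X(2) Yverts] Y(3) by blast
    then have "card Y \<le> card X" using min g(1) gX by blast
    then have XY: "X = Y"
      using X(2) finite_subset[OF Yverts finite_verts] by (intro card_seteq)
    obtain v where v: "v \<in> verts G" "\<epsilon> v = 0" "\<epsilon>' = \<epsilon>(v := 1)"
      using X(1) by (auto simp: flip_up_def)
    have "X \<in> components (coloured_subgraph G \<epsilon>)" using g(1) gX p by (auto simp: bold_gens_def)
    then have "v \<notin> X" using component_subset[OF G] v(2) by fastforce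
    then have "v \<in> ?V" using v XY by simp
    moreover have "g = ?h v" using v gX XY by (simp add: fun_upd_idem)
    ultimately show False using g(2) by blast
  qed
  have inj: "inj_on ?h ?V"
  proof (rule inj_onI)
    fix u v assume uv: "u \<in> ?V" "v \<in> ?V" "?h u = ?h v"
    then have "(\<epsilon>'(u := 0)) u = (\<epsilon>'(v := 0)) u" by simp
    then show "u = v" using uv(1) by (auto split: if_splits)
  qed
  have "Poly_Mapping.lookup (bold_diff G s p) (\<epsilon>', Y) = sum ?f (Poly_Mapping.keys p \<union> ?h ` ?V)"
    by (rule lookup_extend_linearly[OF fin]) simp
  also have "\<dots> = sum ?f (?h ` ?V)"
    using fin zero by (intro sum.mono_neutral_right) auto
  also have "\<dots> = (\<Sum>v\<in>?V. ?f (?h v))"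
    using inj by (simp add: sum.reindex)
  also have "\<dots> = (\<Sum>v\<in>?V. sign_of_bit (s (\<epsilon>'(v := 0)) \<epsilon>') * Poly_Mapping.lookup p (\<epsilon>'(v := 0), Y))"
    using flip_up_lower[OF Y(1)] Y(2)
    by (intro sum.cong) (auto simp: lookup_bold_diff_gen[OF G])
  finally show ?thesis .
qed

text \<open>
  For a non-dominating \<open>X\<close> some vertex \<open>w\<close> lies outside the closed neighbourhood of \<open>X\<close>, so \<open>w\<close>
  can be recoloured without affecting the component \<open>X\<close>. The chain \<open>b\<close> is obtained from the part
  of \<open>c\<close> at components of size \<open>k\<close> by switching \<open>w\<close> off. This is the standard contraction of a cube
  in the direction \<open>w\<close>. If \<open>\<partial>\<close> is the leading part of the differential and \<open>h\<close> the
  contraction, then \<open>\<partial> h + h \<partial> = id\<close>, and \<open>\<partial>\<close> kills the leading part of \<open>c\<close> because the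
  differential of \<open>c\<close> has only dominating terms. So \<open>b\<close> bounds that leading part up to
  larger or dominating components.
\<close>

lemma clear_smallest_components:
  fixes c :: "'a bold_gen \<Rightarrow>\<^sub>0 'k::field"
  assumes G: "graph G" and s: "sign_assignment G s"
    and c: "Poly_Mapping.keys c \<subseteq> bold_gens G (Suc j)"
    and dc: "Poly_Mapping.keys (bold_diff G s c) \<subseteq> dominating_gens G (Suc (Suc j))"
    and min: "\<And>\<epsilon> X. (\<epsilon>, X) \<in> Poly_Mapping.keys c \<Longrightarrow> dominating_set G X \<or> k \<le> card X"
  obtains b where "Poly_Mapping.keys b \<subseteq> bold_gens G j"
    and "\<And>\<epsilon> X. (\<epsilon>, X) \<in> Poly_Mapping.keys (c - bold_diff G s b) \<Longrightarrow>
           dominating_set G X \<or> Suc k \<le> card X"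
proof -
  interpret graph G by fact
  define w where "w X = (SOME w. w \<in> verts G \<and> w \<notin> X \<and> (\<forall>u\<in>X. \<not> u \<rightarrow>\<^bsub>G\<^esub> w))" for X
  have w: "w X \<in> verts G" "w X \<notin> X" "\<And>u. u \<in> X \<Longrightarrow> \<not> u \<rightarrow>\<^bsub>G\<^esub> w X"
    if "X \<subseteq> verts G" "\<not> dominating_set G X" for X
  proof -
    have "\<exists>w. w \<in> verts G \<and> w \<notin> X \<and> (\<forall>u\<in>X. \<not> u \<rightarrow>\<^bsub>G\<^esub> w)"
      using that unfolding dominating_set_def by blast
    then have "w X \<in> verts G \<and> w X \<notin> X \<and> (\<forall>u\<in>X. \<not> u \<rightarrow>\<^bsub>G\<^esub> w X)"
      unfolding w_def by (rule someI_ex)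
    then show "w X \<in> verts G" "w X \<notin> X" "\<And>u. u \<in> X \<Longrightarrow> \<not> u \<rightarrow>\<^bsub>G\<^esub> w X" by blast+
  qed
  define f where "f = (\<lambda>(\<epsilon>, X).
    if \<not> dominating_set G X \<and> card X = k \<and> \<epsilon> (w X) = 0
    then sign_of_bit (s \<epsilon> (\<epsilon>(w X := 1))) * Poly_Mapping.lookup c (\<epsilon>(w X := 1), X) else 0)"
  have supp: "(\<epsilon>, X) \<in> bold_gens G j" if "f (\<epsilon>, X) \<noteq> 0" for \<epsilon> X
  proof -
    let ?e = "\<epsilon>(w X := 1)"
    have X: "\<not> dominating_set G X" "\<epsilon> (w X) = 0" "(?e, X) \<in> Poly_Mapping.keys c"
      using that by (auto simp: f_def in_keys_iff split: if_splits)
    then have e: "?e \<in> bicolourings G" "X \<in> components (coloured_subgraph G ?e)"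
        "(\<Sum>v\<in>verts G. ?e v) = Suc j"
      using c by (auto simp: bold_gens_def)
    have "X \<subseteq> verts G" using component_subset[OF G e(2)] by blast
    note wX = w[OF this X(1)]
    have \<epsilon>: "\<epsilon> \<in> bicolourings G"
      using bicolouring_upd[OF e(1) wX(1), of 0] X(2) by (simp add: fun_upd_idem)
    have "(\<Sum>v\<in>verts G. \<epsilon> v) = j"
      using flip_up_sum[OF G flip_up_raise[OF \<epsilon> wX(1) X(2)]] e(3) by simp
    moreover have "X \<in> components (coloured_subgraph G \<epsilon>)"
      using component_flip_nonadjacent[OF G wX] e(2) by blast
    ultimately show ?thesis using \<epsilon> by (simp add: bold_gens_def)
  qed
  define b where "b = Abs_poly_mapping f"
  have "{g. f g \<noteq> 0} \<subseteq> bold_gens G j" using supp by auto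
  then have b: "Poly_Mapping.lookup b = f"
    unfolding b_def using finite_bold_gens[OF G] finite_subset
    by (intro lookup_Abs_poly_mapping) blast
  have keys_b: "Poly_Mapping.keys b \<subseteq> bold_gens G j"
    using supp by (auto simp: in_keys_iff b)
  have "dominating_set G X \<or> Suc k \<le> card X"
    if "(\<epsilon>, X) \<in> Poly_Mapping.keys (c - bold_diff G s b)" for \<epsilon> X
  proof (rule ccontr)
    assume "\<not> (dominating_set G X \<or> Suc k \<le> card X)"
    then have nd: "\<not> dominating_set G X" and le: "card X \<le> k" by auto
    have "(\<epsilon>, X) \<in> bold_gens G (Suc j)"
      using that keys_diff_subset[of c] c bold_diff_keys[OF G keys_b] by blast
    then have \<epsilon>: "\<epsilon> \<in> bicolourings G" and X: "X \<in> components (coloured_subgraph G \<epsilon>)"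
      by (auto simp: bold_gens_def)
    have "X \<subseteq> verts G" using component_subset[OF G X] by blast
    note wX = w[OF this nd]
    let ?w = "w X" and ?V = "{v \<in> verts G. \<epsilon> v = 1} - X"
    have db: "Poly_Mapping.lookup (bold_diff G s b) (\<epsilon>, X) =
        (\<Sum>v\<in>?V. sign_of_bit (s (\<epsilon>(v := 0)) \<epsilon>) * f (\<epsilon>(v := 0), X))"
      unfolding b[symmetric] using keys_b le
      by (intro bold_diff_leading_coefficient[OF G _ _ \<epsilon> X nd])
        (auto simp: in_keys_iff b f_def split: if_splits)
    have "Poly_Mapping.lookup (bold_diff G s b) (\<epsilon>, X) = Poly_Mapping.lookup c (\<epsilon>, X)"
    proof (cases "card X = k")
      case False
      then have "Poly_Mapping.lookup c (\<epsilon>, X) = 0"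
        using min[of \<epsilon> X] nd le by (auto simp: in_keys_iff)
      moreover have "f (\<epsilon>(v := 0), X) = 0" for v using False by (simp add: f_def)
      ultimately show ?thesis unfolding db by simp
    next
      case k: True
      consider "\<epsilon> ?w = 1" | "\<epsilon> ?w = 0"
        using \<epsilon> wX(1) by (auto simp: bicolourings_def PiE_def Pi_def)
      then show ?thesis
      proof cases
        case 1
        \<comment> \<open>Only removing \<open>w\<close> itself reaches a colouring that is \<open>0\<close> at \<open>w\<close>, where \<open>b\<close> can be nonzero.\<close>
        have "(\<Sum>v\<in>?V. sign_of_bit (s (\<epsilon>(v := 0)) \<epsilon>) * f (\<epsilon>(v := 0), X)) =
            (\<Sum>v\<in>{?w}. sign_of_bit (s (\<epsilon>(v := 0)) \<epsilon>) * f (\<epsilon>(v := 0), X))"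
          using 1 wX(1,2) by (intro sum.mono_neutral_right) (auto simp: f_def)
        also have "\<dots> = Poly_Mapping.lookup c (\<epsilon>, X)"
          using 1 k nd by (simp add: f_def mult.assoc[symmetric] sign_of_bit_square fun_upd_idem)
        finally show ?thesis unfolding db .
      next
        case 2
        \<comment> \<open>The coefficient of \<open>bold_diff G s c\<close> at \<open>X\<close> with \<open>w\<close> switched on vanishes. It expresses
          the coefficient of \<open>c\<close> at \<open>X\<close> through the values of \<open>c\<close> that enter the coefficient of
          \<open>bold_diff G s b\<close>, and the sign rule for the squares spanned by \<open>v\<close> and \<open>w\<close> matches the signs.\<close>
        let ?e = "\<epsilon>(?w := 1)"
        define \<sigma> :: 'k where "\<sigma> = sign_of_bit (s \<epsilon> ?e)"
        have e: "?e \<in> bicolourings G" using bicolouring_upd[OF \<epsilon> wX(1)] by simp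
        have eX: "X \<in> components (coloured_subgraph G ?e)"
          using component_flip_nonadjacent[OF G wX] X by blast
        have V: "{v \<in> verts G. ?e v = 1} - X = insert ?w ?V" "?w \<notin> ?V" "finite ?V"
          using wX(1,2) 2 by auto
        have "Poly_Mapping.lookup (bold_diff G s c) (?e, X) =
            (\<Sum>v\<in>insert ?w ?V. sign_of_bit (s (?e(v := 0)) ?e) * Poly_Mapping.lookup c (?e(v := 0), X))"
          unfolding V(1)[symmetric] using min k
          by (intro bold_diff_leading_coefficient[OF G c _ e eX nd]) blast
        moreover have "Poly_Mapping.lookup (bold_diff G s c) (?e, X) = 0"
          using dc nd by (auto simp: in_keys_iff dominating_gens_def)
        ultimately have cyc: "(\<Sum>v\<in>?V. sign_of_bit (s (?e(v := 0)) ?e) *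
            Poly_Mapping.lookup c (?e(v := 0), X)) = - (\<sigma> * Poly_Mapping.lookup c (\<epsilon>, X))"
          using V(2,3) 2 by (simp add: \<sigma>_def fun_upd_idem eq_neg_iff_add_eq_0 add.commute)
        have square: "sign_of_bit (s (\<epsilon>(v := 0)) \<epsilon>) * f (\<epsilon>(v := 0), X) =
            - \<sigma> * (sign_of_bit (s (?e(v := 0)) ?e) * Poly_Mapping.lookup c (?e(v := 0), X))"
          if v: "v \<in> ?V" for v
        proof -
          have vw: "v \<noteq> ?w" using v V(2) by blast
          let ?d = "\<epsilon>(v := 0)"
          have upd: "?d(v := 1) = \<epsilon>" "?d(v := 1, ?w := 1) = ?e" "?d(?w := 1) = ?e(v := 0)"
            using v vw by (auto simp: fun_eq_iff)
          define \<alpha> \<beta> \<gamma> :: 'k where "\<alpha> = sign_of_bit (s ?d \<epsilon>)" and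
            "\<beta> = sign_of_bit (s ?d (?e(v := 0)))" and "\<gamma> = sign_of_bit (s (?e(v := 0)) ?e)"
          have "\<alpha> * \<sigma> = - (\<beta> * \<gamma>)"
            using sign_anticommute[OF s bicolouring_upd[OF \<epsilon>, of v 0] _ wX(1) vw, where 'k = 'k]
              v vw 2 unfolding upd \<alpha>_def \<beta>_def \<gamma>_def \<sigma>_def by simp
          moreover have "\<sigma> * \<sigma> = 1" "\<beta> * \<beta> = 1"
            by (simp_all add: \<sigma>_def \<beta>_def sign_of_bit_square)
          ultimately have "\<alpha> * \<beta> = - \<sigma> * \<gamma>" by algebra
          moreover have "f (?d, X) = \<beta> * Poly_Mapping.lookup c (?e(v := 0), X)"
            using nd k 2 vw upd(3) by (simp add: f_def \<beta>_def)
          ultimately show ?thesis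
            unfolding \<alpha>_def[symmetric] \<gamma>_def[symmetric] by (simp add: mult.assoc[symmetric])
        qed
        have "(\<Sum>v\<in>?V. sign_of_bit (s (\<epsilon>(v := 0)) \<epsilon>) * f (\<epsilon>(v := 0), X)) =
            - \<sigma> * - (\<sigma> * Poly_Mapping.lookup c (\<epsilon>, X))"
          unfolding cyc[symmetric] sum_distrib_left by (rule sum.cong[OF refl square])
        also have "\<dots> = Poly_Mapping.lookup c (\<epsilon>, X)"
          by (simp add: \<sigma>_def mult.assoc[symmetric] sign_of_bit_square)
        finally show ?thesis unfolding db .
      qed
    qed
    then show False using that by (simp add: in_keys_iff lookup_minus)
  qed
  then show ?thesis using keys_b that by blast
qed

text \<open>
  Subtracting boundaries raises the minimal size \<open>k\<close> of the non-dominating components of \<open>c\<close>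
  without changing the differential of \<open>c\<close>. No component has more than \<open>card (verts G)\<close> vertices, so
  eventually only dominating components remain.
\<close>

lemma push_into_dominating:
  fixes c :: "'a bold_gen \<Rightarrow>\<^sub>0 'k::field"
  assumes G: "graph G" and s: "sign_assignment G s"
    and "Poly_Mapping.keys c \<subseteq> bold_gens G (Suc j)"
    and "Poly_Mapping.keys (bold_diff G s c) \<subseteq> dominating_gens G (Suc (Suc j))"
    and "\<And>\<epsilon> X. (\<epsilon>, X) \<in> Poly_Mapping.keys c \<Longrightarrow> dominating_set G X \<or> k \<le> card X"
  shows "\<exists>b. Poly_Mapping.keys b \<subseteq> bold_gens G j \<and>
    Poly_Mapping.keys (c - bold_diff G s b) \<subseteq> dominating_gens G (Suc j)"
  using assms(3-5)
proof (induction "Suc (card (verts G)) - k" arbitrary: c k)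
  case 0
  interpret graph G by fact
  have "dominating_set G X" if "(\<epsilon>, X) \<in> Poly_Mapping.keys c" for \<epsilon> X
  proof -
    have "X \<in> components (coloured_subgraph G \<epsilon>)" using that 0(2) by (auto simp: bold_gens_def)
    then have "X \<subseteq> verts G" using component_subset[OF G] by blast
    then have "card X \<le> card (verts G)" by (rule card_mono[OF finite_verts])
    then show ?thesis using 0(1) 0(4)[OF that] by auto
  qed
  then have "Poly_Mapping.keys (c - bold_diff G s 0) \<subseteq> dominating_gens G (Suc j)"
    using 0(2) by (auto simp: dominating_gens_def extend_linearly_def)
  then show ?case by (intro exI[of _ 0]) simp
next
  case (Suc m)
  obtain b where b: "Poly_Mapping.keys b \<subseteq> bold_gens G j"
    "\<And>\<epsilon> X. (\<epsilon>, X) \<in> Poly_Mapping.keys (c - bold_diff G s b) \<Longrightarrow>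
       dominating_set G X \<or> Suc k \<le> card X"
  proof (rule clear_smallest_components[OF G s Suc(3,4)])
    show "dominating_set G X \<or> k \<le> card X" if "(\<epsilon>, X) \<in> Poly_Mapping.keys c" for \<epsilon> X
      using that by (rule Suc(5))
  qed blast
  let ?c = "c - bold_diff G s b"
  have "Poly_Mapping.keys ?c \<subseteq> bold_gens G (Suc j)"
    using keys_diff_subset[of c] Suc(3) bold_diff_keys[OF G b(1)] by blast
  moreover have "bold_diff G s ?c = bold_diff G s c"
    by (simp add: extend_linearly_diff bold_diff_diff[OF G s b(1)])
  moreover have "m = Suc (card (verts G)) - Suc k" using Suc(2) by arith
  ultimately obtain b' where b': "Poly_Mapping.keys b' \<subseteq> bold_gens G j"
    "Poly_Mapping.keys (?c - bold_diff G s b') \<subseteq> dominating_gens G (Suc j)"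
    using Suc(1)[of "Suc k" ?c] Suc(4) b(2) by auto
  have "Poly_Mapping.keys (b + b') \<subseteq> bold_gens G j"
    using keys_add[of b b'] b(1) b'(1) by blast
  moreover have "?c - bold_diff G s b' = c - bold_diff G s (b + b')"
    by (simp add: extend_linearly_add algebra_simps)
  ultimately show ?case using b'(2) by metis
qed

lemma bold_gens_0:
  assumes "graph G"
  shows "bold_gens G 0 = {}"
proof (rule ccontr)
  interpret graph G by fact
  assume "bold_gens G 0 \<noteq> {}"
  then obtain \<epsilon> X where X: "(\<Sum>v\<in>verts G. \<epsilon> v) = 0" "X \<in> components (coloured_subgraph G \<epsilon>)"
    by (auto simp: bold_gens_def)
  then show False
    using components_nonempty[OF X(2)] component_subset[OF assms X(2)] by fastforce
qed


section \<open>The quasi-isomorphism\<close>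

theorem theorem1p3:
  fixes G :: "('a, 'b) pre_digraph"
    and s :: "('a \<Rightarrow> nat) \<Rightarrow> ('a \<Rightarrow> nat) \<Rightarrow> bit"
  assumes "graph G"
    and "Digraph_Component.connected G"
    and "sign_assignment G s"
  shows "\<exists>f. quasi_isomorphism
               (dominating_complex G s :: ('a bold_gen, 'k::field) cpx)
               (bold_complex G s :: ('a bold_gen, 'k) cpx) f"
proof -
  let ?C = "bold_complex G s :: ('a bold_gen, 'k) cpx"
  let ?D = "dominating_complex G s :: ('a bold_gen, 'k) cpx"
  have "quasi_isomorphism ?D ?C (\<lambda>i x. x)"
  proof (rule inclusion_quasi_isomorphism)
    show "chain_complex ?C" using assms(1,3) by (rule chain_complex_bold)
    show "chain_complex ?D" using assms(1,3) by (rule chain_complex_dominating)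
    show "chains ?D i \<subseteq> chains ?C i" for i
      by (auto simp: dominating_complex_def bold_complex_def dominating_gens_def)
    show "diff ?D = diff ?C" by (simp add: dominating_complex_def)
    fix i c
    assume c: "c \<in> chains ?C i" "diff ?C i c \<in> chains ?D (Suc i)"
    show "\<exists>b\<in>boundaries ?C i. c - b \<in> chains ?D i"
    proof (cases i)
      case 0
      then have "c = 0" using c(1) bold_gens_0[OF assms(1)] by (simp add: bold_complex_def)
      then show ?thesis using 0 by (simp add: boundaries_def dominating_complex_def)
    next
      case (Suc j)
      \<comment> \<open>The filtration starts at size \<open>0\<close>, where its condition is void.\<close>
      obtain b where "Poly_Mapping.keys b \<subseteq> bold_gens G j"
        "Poly_Mapping.keys (c - bold_diff G s b) \<subseteq> dominating_gens G (Suc j)"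
        using push_into_dominating[OF assms(1,3), of c j 0] c Suc
        by (auto simp: bold_complex_def dominating_complex_def)
      then show ?thesis
        using Suc by (auto simp: boundaries_def bold_complex_def dominating_complex_def)
    qed
  qed
  then show ?thesis by blast
qed

end
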